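(* Let $A=(a_i(j))\in\mathbb{R}^{m\times n}$ be a matrix whose columns $A^j$ satisfy $\|A^j\|_2\le L$ for all $j\in[n]$ and whose entries satisfy $|a_i(j)|\le M$ for all $i\in[m]$, $j\in[n]$. Let $h:\mathbb{R}^+\to\mathbb{R}^+$ be a non-increasing function such that for every subset $S\subseteq[n]$ and every $i\in[m]$, \[\sum_{j\in S}a_i(j)^2\le |S|\cdot h(|S|).\] Then for any $p>1$ there exists a vector $x\in\{-1,1\}^n$ such that $\|Ax\|_\infty\le 5b_0+2M$, where \[b_0=\min\left(\sqrt{8(p+1)(48m)^{1/p}\cdot\beta},\;250\,L\sqrt{\log(2m)}\right),\qquad \beta=\int_{0}^{n-2}h(n-t)\,(n-t)^{-1/p}\,dt.\]
   Context: $A^j$ denotes the $j$-th column of $A$ and $a_i$ its $i$-th row, with entries $a_i(j)$. $\|\cdot\|_\infty$ is the maximum absolute value of the entries of a vector. *)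

theory Defs
  imports "HOL-Analysis.Analysis"
begin

text \<open>
  For \<open>n \<le> 1\<close> the domain of integration is empty and the value is \<open>0\<close>; the oriented
  integral would be negative there, and its square root below would not make sense.
\<close>

definition beta_bound :: "(real \<Rightarrow> real) \<Rightarrow> real \<Rightarrow> nat \<Rightarrow> real" where
  "beta_bound h p n = integral {0..real n - 2} (\<lambda>t. h (real n - t) * (real n - t) powr (- 1 / p))"

definition b0_bound :: "(real \<Rightarrow> real) \<Rightarrow> real \<Rightarrow> real \<Rightarrow> nat \<Rightarrow> nat \<Rightarrow> real" where
  "b0_bound h p L m n =
     min (sqrt (8 * (p + 1) * (48 * real m) powr (1 / p) * beta_bound h p n))
         (250 * L * sqrt (ln (2 * real m)))"

end

theory Submission
  imports Defs "HOL-Real_Asymp.Real_Asymp"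
begin

text \<open>
  The two bounds in the minimum are proved separately.

  For the bound with \<open>\<beta>\<close>, give every signed row the slack \<open>B (\<parallel>x\<parallel>\<^sup>2) - a\<^sub>k \<bullet> x\<close>, where the barrier \<open>B\<close>
  grows like the integral defining \<open>\<beta>\<close>, and take a point \<open>x\<close> of the cube with
  \<open>\<parallel>x\<parallel>\<^sup>2 \<le> n - 2\<close> that maximises \<open>\<parallel>x\<parallel>\<close> among those for which the potential \<open>\<Sum>\<^sub>k slack\<^sub>k powr (- p)\<close> is
  at most its value at \<open>0\<close>. If \<open>\<parallel>x\<parallel>\<^sup>2 < n - 2\<close>, more than two coordinates are not yet \<open>\<plusminus>1\<close>; among
  the directions supported on them, orthogonal to \<open>x\<close> and to the few rows of smallest slack, an
  average over an orthonormal basis yields one in which the potential has negative second-order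
  change, so moving one way or the other contradicts maximality. Hence \<open>\<parallel>x\<parallel>\<^sup>2 = n - 2\<close>, and rounding
  to signs moves each row by at most \<open>M \<Sum>\<^sub>j (1 - x\<^sub>j\<^sup>2) = 2 M\<close>.

  For the bound with \<open>L\<close>, derandomise the Gram--Schmidt walk: the pivot coordinate moves by \<open>d\<close> and
  the other fractional ones so that \<open>A x\<close> moves by \<open>d\<close> times the part of the pivot column orthogonal
  to the other fractional columns. The conditional expectations of \<open>exp (A z \<bullet> v)\<close> are controlled by
  \<open>exp (\<parallel>P v\<parallel>\<^sup>2 / 2)\<close>, with \<open>P\<close> the projection to the span of the fractional columns, sharpened by the
  factor \<open>two_point_excess\<close> for the pivot.
\<close>

subsection \<open>The barrier argument\<close>

text \<open>Second-order Taylor expansion of \<open>f = (\<lambda>s. s powr (- p))\<close>: the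
  terms linear in \<open>v\<close> cancel between the two signs, and
  \<open>f''(s) * v\<^sup>2 + 2 * D * f'(s)\<close> remains. Here \<open>v\<close> is the speed of a
  row and \<open>D\<close> the speed at which the barrier rises.\<close>

lemma powr_second_difference_tendsto:
  fixes s D v p :: real
  assumes "s > 0" "p > 0"
  shows "((\<lambda>d. ((s + D * d\<^sup>2 - d * v) powr (- p) + (s + D * d\<^sup>2 + d * v) powr (- p)
              - 2 * s powr (- p)) / d\<^sup>2)
          \<longlongrightarrow> s powr (- p) * (p * (p + 1) * v\<^sup>2 / s\<^sup>2 - 2 * p * D / s)) (at_right 0)"
  using assms by (real_asymp simp: field_simps power2_eq_square)

lemma bessel_finite:
  fixes B :: "'a::euclidean_space set" and a :: 'a
  assumes "finite B" "pairwise orthogonal B" "\<And>e. e \<in> B \<Longrightarrow> norm e = 1"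
  shows "(\<Sum>e\<in>B. (a \<bullet> e)\<^sup>2) \<le> (norm a)\<^sup>2"
proof -
  let ?s = "\<Sum>e\<in>B. (a \<bullet> e) *\<^sub>R e"
  have "?s \<bullet> ?s = (\<Sum>e\<in>B. (norm ((a \<bullet> e) *\<^sub>R e))\<^sup>2)"
    unfolding power2_norm_eq_inner[of ?s, symmetric]
    by (rule norm_sum_Pythagorean) (use assms in \<open>auto simp: pairwise_def orthogonal_def\<close>)
  then have 1: "?s \<bullet> ?s = (\<Sum>e\<in>B. (a \<bullet> e)\<^sup>2)"
    using assms(3) by (simp add: power_mult_distrib)
  have 2: "a \<bullet> ?s = (\<Sum>e\<in>B. (a \<bullet> e)\<^sup>2)"
    by (simp add: inner_sum_right power2_eq_square)
  have "0 \<le> (a - ?s) \<bullet> (a - ?s)" by simp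
  also have "\<dots> = a \<bullet> a - 2 * (a \<bullet> ?s) + ?s \<bullet> ?s"
    by (simp add: inner_diff_left inner_diff_right inner_commute)
  finally show ?thesis using 1 2 by (simp add: power2_norm_eq_inner)
qed

lemma dim_orthogonal_complement_ge:
  fixes C :: "'a::euclidean_space set"
  assumes "finite C"
  shows "subspace {y. \<forall>c\<in>C. c \<bullet> y = 0}"
    and "DIM('a) - card C \<le> dim {y. \<forall>c\<in>C. c \<bullet> y = 0}"
proof -
  show "subspace {y. \<forall>c\<in>C. c \<bullet> y = 0}"
    by (auto simp: subspace_def inner_add_right)
  have eq: "{y. \<forall>c\<in>C. c \<bullet> y = 0} = {y\<in>UNIV. \<forall>x\<in>span C. orthogonal x y}"
  proof (intro set_eqI iffI)
    fix y assume "y \<in> {y. \<forall>c\<in>C. c \<bullet> y = 0}"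
    then have "\<And>c. c \<in> C \<Longrightarrow> orthogonal y c" by (auto simp: orthogonal_def inner_commute)
    then show "y \<in> {y\<in>UNIV. \<forall>x\<in>span C. orthogonal x y}"
      by (auto simp: orthogonal_commute[of _ y] intro: orthogonal_to_span)
  next
    fix y assume "y \<in> {y\<in>UNIV. \<forall>x\<in>span C. orthogonal x y}"
    then show "y \<in> {y. \<forall>c\<in>C. c \<bullet> y = 0}" by (auto simp: orthogonal_def span_base)
  qed
  have "dim {y\<in>UNIV. \<forall>x\<in>span C. orthogonal x y} + dim (span C) = dim (UNIV::'a set)"
    by (rule dim_subspace_orthogonal_to_vectors) auto
  moreover have "dim (span C) \<le> card C" using assms by (simp add: dim_le_card')
  ultimately show "DIM('a) - card C \<le> dim {y. \<forall>c\<in>C. c \<bullet> y = 0}"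
    unfolding eq by simp
qed

lemma markov_card:
  fixes f :: "'k \<Rightarrow> real"
  assumes "finite I" "\<And>k. k \<in> I \<Longrightarrow> f k \<ge> 0" "c \<ge> 0"
  shows "real (card {k\<in>I. f k > c}) * c \<le> sum f I"
proof -
  have "real (card {k\<in>I. f k > c}) * c = (\<Sum>k\<in>{k\<in>I. f k > c}. c)" by simp
  also have "\<dots> \<le> (\<Sum>k\<in>{k\<in>I. f k > c}. f k)" by (rule sum_mono) auto
  also have "\<dots> \<le> sum f I" by (rule sum_mono2) (use assms in auto)
  finally show ?thesis .
qed

text \<open>The integral of an increasing function is convex and lies above its tangent lines. This
  turns growth of the squared norm into growth of the barrier.\<close>

lemma integral_increment_ge:
  fixes H :: "real \<Rightarrow> real"
  assumes mono: "mono_on {0..T} H" and "0 \<le> t" "t \<le> t'" "t' \<le> T"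
  shows "integral {0..t'} H \<ge> integral {0..t} H + (t' - t) * H t"
proof -
  have int: "H integrable_on {a..b}" if "0 \<le> a" "b \<le> T" for a b
    by (rule integrable_on_mono_on, rule mono_on_subset[OF mono]) (use that in auto)
  have "integral {0..t} H + integral {t..t'} H = integral {0..t'} H"
    by (rule Henstock_Kurzweil_Integration.integral_combine) (use assms int in auto)
  moreover have "integral {t..t'} (\<lambda>_. H t) \<le> integral {t..t'} H"
    by (rule integral_le) (use assms int in \<open>auto intro!: mono_onD[OF mono]\<close>)
  ultimately show ?thesis using assms by simp
qed

text \<open>Replacing \<open>x $ j\<close> by its sign costs \<open>1 - \<bar>x $ j\<bar>\<close>,
  which is at most \<open>1 - (x $ j)\<^sup>2\<close>, and the latter quantities add up to the
  dimension minus the squared norm, hence to at most 2.\<close>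

lemma round_to_signs:
  fixes A :: "real ^ 'n ^ 'm" and x :: "real ^ 'n"
  assumes entries: "\<And>i j. \<bar>A $ i $ j\<bar> \<le> M"
    and cube: "\<And>j. \<bar>x $ j\<bar> \<le> 1"
    and large: "(norm x)\<^sup>2 \<ge> real CARD('n) - 2"
    and bnd: "\<And>i. \<bar>A $ i \<bullet> x\<bar> \<le> b"
  shows "\<exists>z :: real ^ 'n. (\<forall>j. z $ j \<in> {-1, 1}) \<and> infnorm (A *v z) \<le> b + 2 * M"
proof -
  define z :: "real ^ 'n" where "z = (\<chi> j. if x $ j \<ge> 0 then 1 else -1)"
  have M: "M \<ge> 0" using entries by (meson abs_ge_zero order_trans)
  have dz: "\<bar>z $ j - x $ j\<bar> \<le> 1 - (x $ j)\<^sup>2" for j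
  proof -
    have "\<bar>z $ j - x $ j\<bar> = 1 - \<bar>x $ j\<bar>" using cube[of j] by (auto simp: z_def)
    also have "\<dots> \<le> 1 - \<bar>x $ j\<bar>\<^sup>2"
      using cube[of j] mult_left_le[of "\<bar>x $ j\<bar>" "\<bar>x $ j\<bar>"] by (simp add: power2_eq_square)
    finally show ?thesis by simp
  qed
  have n2: "(norm x)\<^sup>2 = (\<Sum>j\<in>UNIV. (x $ j)\<^sup>2)"
    by (simp add: norm_vec_def L2_set_def sum_nonneg)
  have tot: "(\<Sum>j\<in>UNIV. 1 - (x $ j)\<^sup>2) \<le> 2"
    using large n2 by (simp add: sum_subtractf)
  have "\<bar>(A *v z) $ i\<bar> \<le> b + 2 * M" for i
  proof -
    have "(A *v z) $ i = A $ i \<bullet> x + (\<Sum>j\<in>UNIV. A $ i $ j * (z $ j - x $ j))"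
      by (simp add: matrix_vector_mult_def inner_vec_def sum.distrib[symmetric] algebra_simps)
    also have "\<bar>\<dots>\<bar> \<le> \<bar>A $ i \<bullet> x\<bar> + (\<Sum>j\<in>UNIV. \<bar>A $ i $ j * (z $ j - x $ j)\<bar>)"
      by (rule order_trans[OF abs_triangle_ineq add_left_mono[OF sum_abs]])
    also have "(\<Sum>j\<in>UNIV. \<bar>A $ i $ j * (z $ j - x $ j)\<bar>) \<le> (\<Sum>j\<in>UNIV. M * (1 - (x $ j)\<^sup>2))"
      unfolding abs_mult by (intro sum_mono mult_mono entries dz M) auto
    also have "\<dots> \<le> M * 2" unfolding sum_distrib_left[symmetric] by (intro mult_left_mono tot M)
    finally show ?thesis using bnd[of i] by linarith
  qed
  then have "infnorm (A *v z) \<le> b + 2 * M"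
    unfolding infnorm_cart by (intro cSup_least) auto
  then show ?thesis by (intro exI[of _ z]) (auto simp: z_def)
qed

section \<open>A direction in which the potential decreases to second order\<close>

text \<open>Averaging over an orthonormal basis of the admissible directions. Rows of small slack
  are made orthogonal to all of them. For the other rows Bessel's inequality bounds the mean squared
  speed by \<open>2 * h r\<close>, and their slack is large enough for the rise \<open>D\<close> of
  the barrier to outweigh it.\<close>

lemma exists_descent_direction:
  fixes a :: "'k::finite \<Rightarrow> real ^ 'n" and x :: "real ^ 'n" and s :: "'k \<Rightarrow> real"
  assumes h_range: "h ` {0<..} \<subseteq> {0..}"
    and h_antimono: "antimono_on {0<..} h"
    and rows: "\<And>S k. (\<Sum>j\<in>S. (a k $ j)\<^sup>2) \<le> real (card S) * h (real (card S))"
    and p: "p > 1"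
    and cube: "\<And>j. \<bar>x $ j\<bar> \<le> 1"
    and r: "r = real CARD('n) - (norm x)\<^sup>2" "r > 2"
    and s: "\<And>k. s k > 0" and \<Phi>: "(\<Sum>k\<in>UNIV. s k powr (- p)) \<le> \<Phi>"
    and D: "D > (p + 1) * h r * (24 * \<Phi> / r) powr (1 / p)"
  obtains u where "norm u = 1" "x \<bullet> u = 0" "\<And>j. \<bar>x $ j\<bar> = 1 \<Longrightarrow> u $ j = 0"
    "(\<Sum>k\<in>UNIV. s k powr (- p) * (p * (p + 1) * (a k \<bullet> u)\<^sup>2 / (s k)\<^sup>2 - 2 * p * D / s k)) < 0"
proof -
  define J where "J = {j. \<bar>x $ j\<bar> < 1}"
  define N where "N = card J"
  have n2: "(norm x)\<^sup>2 = (\<Sum>j\<in>UNIV. (x $ j)\<^sup>2)"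
    by (simp add: norm_vec_def L2_set_def sum_nonneg)
  have "r = (\<Sum>j\<in>UNIV. 1 - (x $ j)\<^sup>2)" using r n2 by (simp add: sum_subtractf)
  also have "\<dots> \<le> (\<Sum>j\<in>UNIV. if j \<in> J then 1 else 0)"
  proof (rule sum_mono)
    fix j show "1 - (x $ j)\<^sup>2 \<le> (if j \<in> J then 1 else 0)"
      using cube[of j] power2_abs[of "x $ j"] by (cases "\<bar>x $ j\<bar> = 1") (auto simp: J_def)
  qed
  also have "\<dots> = real N" by (simp add: sum.If_cases N_def)
  finally have rN: "r \<le> real N" .
  then have N3: "N \<ge> 3" using r by linarith
  have hr: "h r \<ge> 0" using h_range r by (simp add: image_subset_iff)
  have hN: "h (real N) \<le> h r"
    by (rule monotone_onD[OF h_antimono]) (use rN r in auto)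
  have "0 < (\<Sum>k\<in>UNIV. s k powr (- p))" by (rule sum_pos) (use s in \<open>auto simp: less_imp_neq[THEN not_sym]\<close>)
  then have \<Phi>0: "\<Phi> > 0" using \<Phi> by linarith
  \<comment> \<open>With this threshold, Markov's inequality leaves at most \<open>N / 24\<close>
    rows in the set \<open>T\<close> of rows of small slack.\<close>
  define c where "c = 24 * \<Phi> / real N"
  have c0: "c > 0" using \<Phi>0 N3 by (simp add: c_def)
  define T where "T = {k\<in>UNIV. s k powr (- p) > c}"
  have "real (card T) * c \<le> (\<Sum>k\<in>UNIV. s k powr (- p))"
    unfolding T_def by (rule markov_card) (use c0 in auto)
  with \<Phi> have "real (card T) * c \<le> \<Phi>" by linarith
  then have "real (card T) * 24 \<le> real N" using N3 \<Phi>0 by (simp add: c_def field_simps)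
  then have cT: "24 * card T \<le> N" by linarith
  define C where "C = insert x (a ` T \<union> (\<lambda>j. axis j 1) ` (- J))"
  have finC: "finite C" by (simp add: C_def)
  have "card C \<le> Suc (card (a ` T \<union> (\<lambda>j. axis j (1::real)) ` (- J)))"
    unfolding C_def by (rule card_insert_le_m1) auto
  also have "card (a ` T \<union> (\<lambda>j. axis j (1::real)) ` (- J)) \<le> card T + card (- J)"
    by (intro order_trans[OF card_Un_le] add_mono card_image_le) auto
  finally have cC: "card C \<le> Suc (card T + (CARD('n) - N))"
    by (simp add: N_def Compl_eq_Diff_UNIV card_Diff_subset)
  have NJ: "N \<le> CARD('n)" unfolding N_def by (rule card_mono) auto
  define W where "W = {y. \<forall>c\<in>C. c \<bullet> y = 0}"
  have W: "subspace W" "DIM(real ^ 'n) - card C \<le> dim W"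
    unfolding W_def by (rule dim_orthogonal_complement_ge[OF finC])+
  \<comment> \<open>The constraints leave dimension at least \<open>N - 1 - N / 24\<close>. This is
    at least \<open>N / 2\<close> because \<open>N\<close> is at least 3, which is where
    \<open>r > 2\<close> enters.\<close>
  have "2 * (DIM(real ^ 'n) - card C) \<ge> N" using cC cT N3 NJ by simp
  with W have dW: "2 * dim W \<ge> N" by linarith
  obtain B where B: "B \<subseteq> W" "pairwise orthogonal B" "\<And>e. e \<in> B \<Longrightarrow> norm e = 1"
      "independent B" "card B = dim W"
    using orthonormal_basis_subspace[OF W(1)] by metis
  have finB: "finite B" using B(4) by (rule independent_imp_finite)
  have supp: "e $ j = 0" if "e \<in> B" "j \<notin> J" for e j
  proof -
    have "axis j 1 \<in> C" using that by (auto simp: C_def)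
    then have "axis j 1 \<bullet> e = 0" using that B(1) by (auto simp: W_def)
    then show ?thesis by (simp add: inner_axis')
  qed
  define \<kappa> where "\<kappa> = (24 * \<Phi> / r) powr (1 / p)"
  have k0: "\<kappa> \<ge> 0" by (simp add: \<kappa>_def)
  have D0: "D > 0" using D hr k0 p
    by (smt (verit) \<kappa>_def mult_nonneg_nonneg)
  have dpos: "real (dim W) > 0" using dW N3 by linarith
  have neg: "(\<Sum>e\<in>B. (p + 1) * (a k \<bullet> e)\<^sup>2 / s k - 2 * D) < 0" for k
  proof (cases "k \<in> T")
    case True
    then have "a k \<bullet> e = 0" if "e \<in> B" for e
      using that B(1) by (auto simp: C_def W_def)
    then show ?thesis using D0 dpos B(5) by simp
  next
    case False
    \<comment> \<open>The basis vectors vanish off \<open>J\<close>, so the row may be cut down to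
      \<open>J\<close> before Bessel's inequality; the row hypothesis for the set \<open>J\<close>
      then applies.\<close>
    define a' :: "real ^ 'n" where "a' = (\<chi> j. if j \<in> J then a k $ j else 0)"
    have a': "a k \<bullet> e = a' \<bullet> e" if "e \<in> B" for e
      unfolding inner_vec_def a'_def by (rule sum.cong) (use supp[OF that] in auto)
    have "(\<Sum>e\<in>B. (a k \<bullet> e)\<^sup>2) \<le> (norm a')\<^sup>2"
      using bessel_finite[OF finB B(2,3), of a'] by (simp add: a')
    also have "\<dots> = (\<Sum>j\<in>J. (a k $ j)\<^sup>2)"
      unfolding a'_def by (simp add: norm_vec_def L2_set_def sum_nonneg if_distrib[of "\<lambda>x. x\<^sup>2"]
          if_distrib[of abs] sum.If_cases cong: if_cong)
    also have "\<dots> \<le> real N * h (real N)" using rows by (simp add: N_def)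
    also have "\<dots> \<le> (2 * real (dim W)) * h r"
      by (intro mult_mono hN) (use dW hr h_range N3 in \<open>auto simp: image_subset_iff\<close>)
    finally have E: "(\<Sum>e\<in>B. (a k \<bullet> e)\<^sup>2) \<le> 2 * real (dim W) * h r" .
    have "1 / s k = (s k powr (- p)) powr (1 / p)"
      using s[of k] p by (simp add: powr_powr powr_neg_one)
    also have "\<dots> \<le> (24 * \<Phi> / r) powr (1 / p)"
    proof (rule powr_mono2)
      have "s k powr (- p) \<le> c" using False by (simp add: T_def)
      also have "\<dots> \<le> 24 * \<Phi> / r" unfolding c_def
        by (rule divide_left_mono) (use rN r \<Phi>0 N3 in auto)
      finally show "s k powr (- p) \<le> 24 * \<Phi> / r" .
    qed (use p in auto)
    finally have sk: "1 / s k \<le> \<kappa>" by (simp add: \<kappa>_def)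
    have "(\<Sum>e\<in>B. (p + 1) * (a k \<bullet> e)\<^sup>2 / s k) = ((p + 1) * (\<Sum>e\<in>B. (a k \<bullet> e)\<^sup>2)) * (1 / s k)"
      by (simp add: sum_distrib_left sum_divide_distrib)
    also have "\<dots> \<le> ((p + 1) * (2 * real (dim W) * h r)) * \<kappa>"
      by (intro mult_mono E sk mult_left_mono) (use p hr s[of k] in \<open>auto simp: less_imp_le\<close>)
    also have "\<dots> = (2 * real (dim W)) * ((p + 1) * h r * \<kappa>)" by (simp add: algebra_simps)
    also have "\<dots> < (2 * real (dim W)) * D"
      using D dpos by (intro mult_strict_left_mono) (auto simp: \<kappa>_def)
    finally show ?thesis by (simp add: sum_subtractf B(5) algebra_simps)
  qed
  define q where "q k u = s k powr (- p) * (p * (p + 1) * (a k \<bullet> u)\<^sup>2 / (s k)\<^sup>2 - 2 * p * D / s k)" for k u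
  have q: "q k u = (p * s k powr (- p) / s k) * ((p + 1) * (a k \<bullet> u)\<^sup>2 / s k - 2 * D)" for k u
    using s[of k] by (simp add: q_def field_simps power2_eq_square)
  \<comment> \<open>Summed over the basis, every row contributes a negative amount. After exchanging
    the sums, some basis vector must have a negative total.\<close>
  have "(\<Sum>e\<in>B. \<Sum>k\<in>UNIV. q k e) = (\<Sum>k\<in>UNIV. \<Sum>e\<in>B. q k e)" by (rule sum.swap)
  also have "\<dots> < (\<Sum>k\<in>(UNIV::'k set). 0)"
  proof (rule sum_strict_mono)
    fix k :: 'k
    have "p * s k powr (- p) / s k > 0" using p s[of k] by simp
    then show "(\<Sum>e\<in>B. q k e) < 0" unfolding q sum_distrib_left[symmetric]
      by (rule mult_pos_neg) (rule neg)
  qed auto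
  finally have "(\<Sum>e\<in>B. \<Sum>k\<in>UNIV. q k e) < 0" by simp
  then obtain e where e: "e \<in> B" "(\<Sum>k\<in>UNIV. q k e) < 0"
    by (meson linorder_not_le sum_nonneg)
  show thesis
  proof (rule that)
    show "norm e = 1" using e B by auto
    show "x \<bullet> e = 0" using e B(1) by (auto simp: W_def C_def)
    show "e $ j = 0" if "\<bar>x $ j\<bar> = 1" for j using supp[OF e(1)] that by (auto simp: J_def)
  qed (use e in \<open>simp add: q_def\<close>)
qed

section \<open>The barrier and a point of maximal norm\<close>

text \<open>Both factors grow as \<open>real n - t\<close> decreases to 2. Monotonicity serves
  twice: it makes the integrand integrable although \<open>h\<close> may jump, and it makes the
  barrier convex.\<close>

lemma mono_on_beta_integrand:
  assumes h_range: "h ` {0<..} \<subseteq> {0..}"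
    and h_antimono: "antimono_on {0<..} h" and p: "p > 0"
  shows "mono_on {0..real n - 2} (\<lambda>t. h (real n - t) * (real n - t) powr (- 1 / p))"
proof (rule mono_onI)
  fix r t :: real assume rt: "r \<in> {0..real n - 2}" "t \<in> {0..real n - 2}" "r \<le> t"
  have "h (real n - r) \<le> h (real n - t)"
    by (rule monotone_onD[OF h_antimono]) (use rt in auto)
  moreover have "(real n - r) powr (- 1 / p) \<le> (real n - t) powr (- 1 / p)"
    by (rule powr_mono2') (use rt p in auto)
  moreover have "h (real n - t) \<ge> 0" using h_range rt by (simp add: image_subset_iff)
  ultimately show "h (real n - r) * (real n - r) powr (- 1 / p) \<le> h (real n - t) * (real n - t) powr (- 1 / p)"
    by (intro mult_mono) auto
qed

text \<open>The barrier starts at \<open>b\<close>, its integral part is at most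
  \<open>b / 8\<close> by \<open>bb\<close>, and its linear part is at most \<open>b\<close>; so it
  never exceeds \<open>5 * b\<close>, and positive slack bounds each row. The bound is one-sided:
  two-sided bounds come from listing each row with both signs.\<close>

lemma barrier_partial_solution:
  fixes a :: "'k::finite \<Rightarrow> real ^ 'n"
  assumes h_range: "h ` {0<..} \<subseteq> {0..}"
    and h_antimono: "antimono_on {0<..} h"
    and rows: "\<And>S k. (\<Sum>j\<in>S. (a k $ j)\<^sup>2) \<le> real (card S) * h (real (card S))"
    and p: "p > 1" and b: "b > 0"
    and bb: "8 * (p + 1) * (24 * real CARD('k)) powr (1 / p) * beta_bound h p CARD('n) \<le> b\<^sup>2"
  shows "\<exists>x. (\<forall>j. \<bar>x $ j\<bar> \<le> 1) \<and> (norm x)\<^sup>2 \<ge> real CARD('n) - 2 \<and> (\<forall>k. a k \<bullet> x \<le> 5 * b)"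
proof (cases "CARD('n) \<le> 2")
  case True
  then show ?thesis using b by (intro exI[of _ 0]) auto
next
  case False
  define n where "n = real CARD('n)"
  have n: "n \<ge> 3" using False by (simp add: n_def)
  define \<kappa> where "\<kappa> = (24 * real CARD('k)) powr (1 / p)"
  define H where "H = (\<lambda>t. h (n - t) * (n - t) powr (- 1 / p))"
  have monoH: "mono_on {0..n - 2} H"
    unfolding H_def n_def using mono_on_beta_integrand[OF h_range h_antimono] p by simp
  have intH: "H integrable_on {0..n - 2}" by (rule integrable_on_mono_on[OF monoH])
  have H0: "H t \<ge> 0" if "t \<in> {0..n - 2}" for t
    using that h_range by (auto simp: H_def image_subset_iff)
  have beta: "beta_bound h p CARD('n) = integral {0..n - 2} H"
    by (simp add: beta_bound_def H_def n_def)
  \<comment> \<open>Chosen so that \<open>K * H t\<close> is exactly the threshold for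
    \<open>D\<close> in \<open>exists_descent_direction\<close> when the squared norm is
    \<open>t\<close> and the potential bound is its value at the origin, where all slacks equal
    \<open>b\<close>.\<close>
  define K where "K = (p + 1) * \<kappa> / b"
  have K: "K \<ge> 0" using p b by (simp add: K_def \<kappa>_def)
  \<comment> \<open>The linear term lifts the slope strictly above that threshold, at a total cost
    of at most \<open>b\<close>.\<close>
  define Bar where "Bar t = b + K * integral {0..t} H + b / n * t" for t
  have contBar: "continuous_on {0..n - 2} Bar"
    unfolding Bar_def by (intro continuous_intros indefinite_integral_continuous_1 intH)
  have BarInc: "Bar t' \<ge> Bar t + (t' - t) * (K * H t + b / n)" if "0 \<le> t" "t \<le> t'" "t' \<le> n - 2" for t t'
  proof -
    have "K * integral {0..t'} H \<ge> K * (integral {0..t} H + (t' - t) * H t)"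
      by (rule mult_left_mono[OF integral_increment_ge[OF monoH that] K])
    then show ?thesis by (simp add: Bar_def algebra_simps diff_divide_distrib)
  qed
  have Bar0: "Bar 0 = b" by (simp add: Bar_def)
  have BarT: "Bar (n - 2) \<le> 5 * b"
  proof -
    have "8 * (p + 1) * \<kappa> * integral {0..n - 2} H \<le> b\<^sup>2" using bb beta by (simp add: \<kappa>_def)
    then have "K * integral {0..n - 2} H \<le> b / 8"
      using b by (simp add: K_def field_simps power2_eq_square)
    moreover have "b / n * (n - 2) \<le> b" using n b by (simp add: field_simps)
    ultimately show ?thesis using b by (simp add: Bar_def)
  qed
  have BarLe: "Bar t \<le> 5 * b" if "0 \<le> t" "t \<le> n - 2" for t
  proof -
    have "(n - 2 - t) * (K * H t + b / n) \<ge> 0"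
      using that K H0[of t] b n by (intro mult_nonneg_nonneg add_nonneg_nonneg) auto
    then show ?thesis using BarInc[of t "n - 2"] BarT that by linarith
  qed
  define \<Phi> where "\<Phi> = real CARD('k) * b powr (- p)"
  have \<Phi>0: "\<Phi> > 0" using b by (simp add: \<Phi>_def)
  \<comment> \<open>A potential of at most \<open>\<Phi>\<close> forces every positive slack to be
    at least \<open>\<sigma>\<close>, since a single summand is already bounded by
    \<open>\<Phi>\<close>.\<close>
  define \<sigma> where "\<sigma> = \<Phi> powr (- 1 / p)"
  have \<sigma>0: "\<sigma> > 0" using \<Phi>0 by (simp add: \<sigma>_def)
  define sl where "sl x k = Bar ((norm x)\<^sup>2) - a k \<bullet> x" for x k
  define pot where "pot x = (\<Sum>k\<in>UNIV. sl x k powr (- p))" for x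
  have slb: "sl x k \<ge> \<sigma>" if "sl x k > 0" "pot x \<le> \<Phi>" for x k
  proof -
    have "sl x k powr (- p) \<le> pot x" unfolding pot_def by (rule member_le_sum) auto
    with that(2) have "sl x k powr (- p) \<le> \<Phi>" by simp
    then have "\<Phi> powr (- 1 / p) \<le> (sl x k powr (- p)) powr (- 1 / p)"
      by (intro powr_mono2') (use p that in auto)
    then show ?thesis using p that by (simp add: powr_powr \<sigma>_def)
  qed
  define R where "R = {x :: real ^ 'n. (\<forall>j. \<bar>x $ j\<bar> \<le> 1) \<and> (norm x)\<^sup>2 \<le> n - 2}"
  \<comment> \<open>As a function on all reals, \<open>powr\<close> is not infinite at nonpositive
    slacks, so a bound on the potential alone would not exclude them. The uniform lower bound
    \<open>\<sigma>\<close> does, and it keeps the set closed and the potential continuous on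
    it.\<close>
  define R' where "R' = {x \<in> R. \<forall>k. sl x k \<ge> \<sigma>}"
  define X where "X = {x \<in> R'. pot x \<le> \<Phi>}"
  have closedR: "closed R" unfolding R_def
    by (intro closed_Collect_conj closed_Collect_all closed_Collect_le continuous_intros)
  have contsl: "continuous_on R (\<lambda>x. sl x k)" for k
    unfolding sl_def
    by (intro continuous_intros continuous_on_compose2[OF contBar]) (auto simp: R_def)
  have "R' = R \<inter> (\<Inter>k. {x\<in>R. \<sigma> \<le> sl x k})" by (auto simp: R'_def)
  moreover have "closed {x\<in>R. \<sigma> \<le> sl x k}" for k
    by (intro continuous_closed_preimage_constant continuous_on_closed_Collect_le continuous_intros contsl closedR)
  ultimately have closedR': "closed R'" using closedR by auto
  have "sl x k \<noteq> 0" if "x \<in> R'" for x k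
    using that \<sigma>0 by (metis (mono_tags, lifting) R'_def mem_Collect_eq not_le)
  then have contpot: "continuous_on R' pot" unfolding pot_def
    by (intro continuous_intros continuous_on_subset[OF contsl]) (auto simp: R'_def)
  have "closed X" unfolding X_def
    by (intro continuous_on_closed_Collect_le continuous_intros contpot closedR')
  moreover have "bounded X"
  proof (rule boundedI)
    fix x assume "x \<in> X"
    then have "\<And>j. \<bar>x $ j\<bar> \<le> 1" by (simp add: X_def R'_def R_def)
    then have "(\<Sum>j\<in>UNIV. \<bar>x $ j\<bar>) \<le> (\<Sum>j\<in>(UNIV::'n set). 1)" by (intro sum_mono)
    then show "norm x \<le> n" using norm_le_l1_cart[of x] by (simp add: n_def)
  qed
  ultimately have "compact X" by (simp add: compact_eq_bounded_closed)
  moreover have "0 \<in> X"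
  proof -
    have sl0: "sl 0 k = b" for k by (simp add: sl_def Bar0)
    have "pot 0 \<le> \<Phi>" by (simp add: pot_def sl0 \<Phi>_def)
    then show ?thesis using slb[of 0] sl0 b n by (auto simp: X_def R'_def R_def)
  qed
  ultimately obtain x where x: "x \<in> X" "\<And>y. y \<in> X \<Longrightarrow> norm y \<le> norm x"
    using continuous_attains_sup[of X norm] by (auto intro: continuous_intros)
  define t where "t = (norm x)\<^sup>2"
  have cube: "\<bar>x $ j\<bar> \<le> 1" for j using x by (auto simp: X_def R'_def R_def)
  have t: "0 \<le> t" "t \<le> n - 2" using x by (auto simp: X_def R'_def R_def t_def)
  have sp: "sl x k > 0" for k using x(1) \<sigma>0 by (auto simp: X_def R'_def intro: less_le_trans)
  have px: "pot x \<le> \<Phi>" using x by (simp add: X_def)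
  have "t = n - 2"
  proof (rule ccontr)
    assume "t \<noteq> n - 2"
    with t have tn: "t < n - 2" by simp
    define D where "D = K * H t + b / n"
    have "(24 * \<Phi> / (n - t)) powr (1 / p) = \<kappa> / b * (n - t) powr (- 1 / p)"
      using b tn p by (simp add: \<Phi>_def \<kappa>_def powr_mult powr_divide powr_powr powr_minus_divide)
    then have "(p + 1) * h (n - t) * (24 * \<Phi> / (n - t)) powr (1 / p) = K * H t"
      by (simp add: K_def H_def)
    moreover have "b / n > 0" using b n by simp
    ultimately have "D > (p + 1) * h (n - t) * (24 * \<Phi> / (n - t)) powr (1 / p)"
      by (simp add: D_def)
    moreover have "n - t = real CARD('n) - (norm x)\<^sup>2" "n - t > 2"
      using tn by (simp_all add: n_def t_def)
    moreover have "(\<Sum>k\<in>UNIV. sl x k powr (- p)) \<le> \<Phi>" using px by (simp add: pot_def)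
    ultimately obtain u where u: "norm u = 1" "x \<bullet> u = 0" "\<And>j. \<bar>x $ j\<bar> = 1 \<Longrightarrow> u $ j = 0"
      and neg: "(\<Sum>k\<in>UNIV. sl x k powr (- p) * (p * (p + 1) * (a k \<bullet> u)\<^sup>2 / (sl x k)\<^sup>2 - 2 * p * D / sl x k)) < 0"
      using exists_descent_direction[where a = a and s = "sl x", OF h_range h_antimono rows p cube _ _ sp]
      by blast
    have "((\<lambda>d. \<Sum>k\<in>UNIV. ((sl x k + D * d\<^sup>2 - d * (a k \<bullet> u)) powr (- p) + (sl x k + D * d\<^sup>2 + d * (a k \<bullet> u)) powr (- p)
              - 2 * sl x k powr (- p)) / d\<^sup>2) \<longlongrightarrow> 
          (\<Sum>k\<in>UNIV. sl x k powr (- p) * (p * (p + 1) * (a k \<bullet> u)\<^sup>2 / (sl x k)\<^sup>2 - 2 * p * D / sl x k))) (at_right 0)"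
      by (intro tendsto_sum powr_second_difference_tendsto sp) (use p in auto)
    then have ev1: "\<forall>\<^sub>F d in at_right 0. (\<Sum>k\<in>UNIV. ((sl x k + D * d\<^sup>2 - d * (a k \<bullet> u)) powr (- p) + (sl x k + D * d\<^sup>2 + d * (a k \<bullet> u)) powr (- p)
              - 2 * sl x k powr (- p)) / d\<^sup>2) < 0"
      using neg by (rule order_tendstoD)
    have ev2: "\<forall>\<^sub>F d in at_right (0::real). d > 0" by (rule eventually_at_right_less)
    have ev_pos: "\<forall>\<^sub>F d in at_right 0. 0 < f d" if "continuous_on UNIV f" "0 < f 0" for f :: "real \<Rightarrow> real"
    proof (rule order_tendstoD)
      show "(f \<longlongrightarrow> f 0) (at_right 0)"
        using that(1) by (metis continuous_on_def tendsto_mono UNIV_I at_le subset_UNIV)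
    qed (use that in simp)
    have "\<forall>\<^sub>F d in at_right (0::real). 0 < n - 2 - (t + d\<^sup>2)"
      by (rule ev_pos) (use tn in \<open>auto intro!: continuous_intros\<close>)
    then have ev3: "\<forall>\<^sub>F d in at_right (0::real). t + d\<^sup>2 < n - 2" by simp
    have ev4: "\<forall>\<^sub>F d in at_right (0::real). \<forall>k. sl x k + D * d\<^sup>2 + e * d * (a k \<bullet> u) > 0" for e
      by (intro eventually_all_finite ev_pos) (use sp in \<open>auto intro!: continuous_intros\<close>)
    \<comment> \<open>Coordinates already at a sign stay put because \<open>u\<close> vanishes
      there; the others lie strictly inside the interval and tolerate a small move either
      way.\<close>
    have ev5: "\<forall>\<^sub>F d in at_right (0::real). \<forall>j. \<bar>x $ j + e * d * u $ j\<bar> \<le> 1" for e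
    proof (intro eventually_all_finite)
      fix j
      show "\<forall>\<^sub>F d in at_right (0::real). \<bar>x $ j + e * d * u $ j\<bar> \<le> 1"
      proof (cases "\<bar>x $ j\<bar> = 1")
        case True
        then show ?thesis using u(3) by simp
      next
        case False
        then have "\<bar>x $ j\<bar> < 1" using cube[of j] by simp
        then have "\<forall>\<^sub>F d in at_right (0::real). 0 < 1 - \<bar>x $ j + e * d * u $ j\<bar>"
          by (intro ev_pos) (auto intro!: continuous_intros)
        then show ?thesis by (rule eventually_mono) simp
      qed
    qed
    have "\<forall>\<^sub>F d in at_right (0::real). False"
      using ev1 ev2 ev3 ev4[of 1] ev4[of "-1"] ev5[of 1] ev5[of "-1"]
    proof eventually_elim
      case (elim d)
      define sx where "sx e k = sl x k + D * d\<^sup>2 - e * d * (a k \<bullet> u)" for e k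
      \<comment> \<open>Otherwise \<open>x + (e * d) *\<^sub>R u\<close> would be a point of
        \<open>X\<close> whose squared norm is larger by \<open>d\<^sup>2\<close>, as
        \<open>u\<close> is a unit vector orthogonal to \<open>x\<close>.\<close>
      have no: "\<Phi> < (\<Sum>k\<in>UNIV. sx e k powr (- p))" if e: "e = 1 \<or> e = -1" for e
      proof (rule ccontr)
        assume le: "\<not> \<Phi> < (\<Sum>k\<in>UNIV. sx e k powr (- p))"
        define y where "y = x + (e * d) *\<^sub>R u"
        have "(norm y)\<^sup>2 = x \<bullet> x + 2 * (e * d) * (x \<bullet> u) + (e * d)\<^sup>2 * (u \<bullet> u)"
          unfolding power2_norm_eq_inner y_def
          by (simp add: inner_add_left inner_add_right inner_commute power2_eq_square algebra_simps)
        then have ny: "(norm y)\<^sup>2 = t + d\<^sup>2"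
          using u e by (auto simp: t_def power2_norm_eq_inner[symmetric])
        have sxp: "sx e k > 0" for k using elim(4,5) e by (auto simp: sx_def dest: spec[of _ k])
        have ay: "a k \<bullet> y = a k \<bullet> x + e * d * (a k \<bullet> u)" for k
          by (simp add: y_def inner_add_right)
        \<comment> \<open>By convexity the barrier rises by at least \<open>D * d\<^sup>2\<close>,
          so the true slack dominates the quadratic model \<open>sx\<close>.\<close>
        have sly: "sl y k \<ge> sx e k" for k
          using BarInc[of t "t + d\<^sup>2"] t elim(3) 
          by (simp add: sl_def ny ay sx_def D_def t_def[symmetric] algebra_simps)
        have "pot y \<le> (\<Sum>k\<in>UNIV. sx e k powr (- p))"
          unfolding pot_def by (intro sum_mono powr_mono2' sly sxp) (use p in auto)
        with le have py: "pot y \<le> \<Phi>" by simp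
        have "y \<in> X"
          using slb[OF less_le_trans[OF sxp sly] py] elim(3,6,7) ny py e
          by (auto simp: X_def R'_def R_def y_def)
        then have "(norm y)\<^sup>2 \<le> (norm x)\<^sup>2" using x(2) by (intro power_mono) auto
        then show False using ny elim(2) by (simp add: t_def)
      qed
      \<comment> \<open>The two signs together have model potential below \<open>2 * pot x\<close>,
        so they cannot both exceed \<open>\<Phi>\<close>.\<close>
      have "(\<Sum>k\<in>UNIV. sx 1 k powr (- p) + sx (-1) k powr (- p) - 2 * sl x k powr (- p)) < 0"
        using elim(1,2) unfolding sum_divide_distrib[symmetric] by (simp add: sx_def divide_less_0_iff)
      then have "(\<Sum>k\<in>UNIV. sx 1 k powr (- p)) + (\<Sum>k\<in>UNIV. sx (-1) k powr (- p)) < 2 * pot x"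
        by (simp add: sum.distrib sum_subtractf pot_def sum_distrib_left)
      then show False using no[of 1] no[of "-1"] px by simp
    qed
    then show False by simp
  qed
  moreover have "a k \<bullet> x \<le> 5 * b" for k
    using sp[of k] BarLe[OF t] by (simp add: sl_def t_def)
  ultimately show ?thesis using cube by (intro exI[of _ x]) (auto simp: t_def n_def)
qed

text \<open>The barrier argument wants a strictly positive \<open>b\<close>, while the square root
  may be 0. It is therefore run for every larger \<open>b\<close>, and a best sign vector satisfies
  all these bounds at once.\<close>

lemma barrier_signs:
  fixes A :: "real ^ 'n ^ 'm"
  assumes entries: "\<And>i j. \<bar>A $ i $ j\<bar> \<le> M"
    and h_range: "h ` {0<..} \<subseteq> {0..}"
    and h_antimono: "antimono_on {0<..} h"
    and rows: "\<And>(S :: 'n set) i. (\<Sum>j\<in>S. (A $ i $ j)\<^sup>2) \<le> real (card S) * h (real (card S))"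
    and p: "p > 1"
  shows "\<exists>z :: real ^ 'n. (\<forall>j. z $ j \<in> {-1, 1}) \<and>
    infnorm (A *v z) \<le> 5 * sqrt (8 * (p + 1) * (48 * real CARD('m)) powr (1 / p) * beta_bound h p CARD('n)) + 2 * M"
proof -
  define X where "X = 8 * (p + 1) * (48 * real CARD('m)) powr (1 / p) * beta_bound h p CARD('n)"
  define Z where "Z = {z :: real ^ 'n. \<forall>j. z $ j \<in> {-1, 1}}"
  have "beta_bound h p CARD('n) \<ge> 0" unfolding beta_bound_def
    by (rule Henstock_Kurzweil_Integration.integral_nonneg[OF integrable_on_mono_on[OF mono_on_beta_integrand[OF h_range h_antimono]]])
       (use p h_range in \<open>auto simp: image_subset_iff\<close>)
  then have X: "X \<ge> 0" using p by (simp add: X_def)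
  have approx: "\<exists>z\<in>Z. infnorm (A *v z) \<le> 5 * b + 2 * M" if b: "b > sqrt X" for b
  proof -
    have b0: "b > 0" using b X real_sqrt_ge_zero[of X] by linarith
    \<comment> \<open>Both signs of every row are listed, which doubles the number of rows and turns
      the constant 24 into 48.\<close>
    define a :: "'m \<times> bool \<Rightarrow> real ^ 'n" where "a = (\<lambda>(i, s). if s then A $ i else - A $ i)"
    have "(\<Sum>j\<in>S. (a k $ j)\<^sup>2) \<le> real (card S) * h (real (card S))" for S k
      using rows[where S = S and i = "fst k"] by (cases k) (simp add: a_def)
    moreover have "X \<le> b\<^sup>2" using b b0 by (metis real_sqrt_le_iff less_imp_le real_sqrt_abs abs_of_pos)
    then have "8 * (p + 1) * (24 * real CARD('m \<times> bool)) powr (1 / p) * beta_bound h p CARD('n) \<le> b\<^sup>2"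
      by (simp add: X_def)
    ultimately obtain x where x: "\<And>j. \<bar>x $ j\<bar> \<le> 1" "(norm x)\<^sup>2 \<ge> real CARD('n) - 2" "\<And>k. a k \<bullet> x \<le> 5 * b"
      using barrier_partial_solution[OF h_range h_antimono _ p b0, of a] by blast
    have "\<bar>A $ i \<bullet> x\<bar> \<le> 5 * b" for i
      using x(3)[of "(i, True)"] x(3)[of "(i, False)"] by (simp add: a_def)
    from round_to_signs[OF entries x(1,2) this] show ?thesis by (auto simp: Z_def)
  qed
  have "finite Z"
  proof -
    have "Z \<subseteq> (\<lambda>f. \<chi> j. f j) ` {f. \<forall>j. f j \<in> {-1, 1 :: real}}"
    proof
      fix z assume "z \<in> Z"
      then show "z \<in> (\<lambda>f. \<chi> j. f j) ` {f. \<forall>j. f j \<in> {-1, 1 :: real}}"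
        by (intro image_eqI[of _ _ "\<lambda>j. z $ j"]) (auto simp: Z_def)
    qed
    moreover have "finite {f :: 'n \<Rightarrow> real. \<forall>j. f j \<in> {-1, 1}}"
      using finite_PiE[of "UNIV :: 'n set" "\<lambda>_. {-1, 1 :: real}"] by (simp add: PiE_def Pi_def)
    ultimately show ?thesis using finite_surj by blast
  qed
  moreover have "Z \<noteq> {}" using approx[of "sqrt X + 1"] by auto
  ultimately obtain z where z: "z \<in> Z" "\<And>y. y \<in> Z \<Longrightarrow> infnorm (A *v z) \<le> infnorm (A *v y)"
    using ex_min_if_finite[of "(\<lambda>z. infnorm (A *v z)) ` Z"] by (fastforce simp: not_less)
  have "infnorm (A *v z) \<le> 5 * sqrt X + 2 * M"
  proof (rule field_le_epsilon)
    fix e :: real assume "e > 0"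
    then obtain y where "y \<in> Z" "infnorm (A *v y) \<le> 5 * (sqrt X + e / 5) + 2 * M"
      using approx[of "sqrt X + e / 5"] by auto
    then show "infnorm (A *v z) \<le> 5 * sqrt X + 2 * M + e" using z(2)[of y] by simp
  qed
  then show ?thesis using z(1) by (auto simp: Z_def X_def)
qed

subsection \<open>The Gram--Schmidt walk\<close>

definition orth_proj :: "'a::euclidean_space set \<Rightarrow> 'a \<Rightarrow> 'a" where
  "orth_proj V x = (SOME y. y \<in> V \<and> (\<forall>w\<in>V. (x - y) \<bullet> w = 0))"

lemma orth_proj:
  assumes "subspace V"
  shows orth_proj_in: "orth_proj V x \<in> V"
    and orth_proj_orthogonal: "w \<in> V \<Longrightarrow> (x - orth_proj V x) \<bullet> w = 0"
proof -
  have "\<exists>y. y \<in> V \<and> (\<forall>w\<in>V. (x - y) \<bullet> w = 0)"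
  proof -
    obtain y z where "y \<in> span V" "\<And>w. w \<in> span V \<Longrightarrow> orthogonal z w" "x = y + z"
      using orthogonal_subspace_decomp_exists by blast
    then show ?thesis using assms by (intro exI[of _ y]) (auto simp: orthogonal_def span_base span_eq_iff[THEN iffD2])
  qed
  then have "orth_proj V x \<in> V \<and> (\<forall>w\<in>V. (x - orth_proj V x) \<bullet> w = 0)"
    unfolding orth_proj_def by (rule someI_ex)
  then show "orth_proj V x \<in> V" "w \<in> V \<Longrightarrow> (x - orth_proj V x) \<bullet> w = 0" by auto
qed

text \<open>Together with \<open>norm_orth_proj_ge\<close>, this says that the squared norm of the
  projection is the maximum of \<open>2 * (x \<bullet> w) - (norm w)\<^sup>2\<close> over
  \<open>w \<in> V\<close>. Later lower bounds come from exhibiting a competitor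
  \<open>w\<close>.\<close>

lemma norm_orth_proj_eq:
  assumes "subspace V"
  shows "(norm (orth_proj V x))\<^sup>2 = 2 * (x \<bullet> orth_proj V x) - (norm (orth_proj V x))\<^sup>2"
  using orth_proj_orthogonal[OF assms orth_proj_in[OF assms], of x x]
  by (simp add: inner_diff_left power2_norm_eq_inner)

lemma norm_orth_proj_ge:
  assumes "subspace V" "w \<in> V"
  shows "2 * (x \<bullet> w) - (norm w)\<^sup>2 \<le> (norm (orth_proj V x))\<^sup>2"
proof -
  have "0 \<le> (orth_proj V x - w) \<bullet> (orth_proj V x - w)" by simp
  then show ?thesis using orth_proj_orthogonal[OF assms, of x]
    by (simp add: inner_diff_left inner_diff_right inner_commute power2_norm_eq_inner)
qed

lemma norm_orth_proj_mono:
  assumes "subspace U" "subspace V" "U \<subseteq> V"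
  shows "(norm (orth_proj U x))\<^sup>2 \<le> (norm (orth_proj V x))\<^sup>2"
  using norm_orth_proj_eq[OF assms(1), of x] norm_orth_proj_ge[OF assms(2), of "orth_proj U x" x]
    orth_proj_in[OF assms(1), of x] assms(3) by auto

lemma norm_orth_proj_residual:
  assumes "subspace V"
  shows "(norm x)\<^sup>2 = (norm (orth_proj V x))\<^sup>2 + (norm (x - orth_proj V x))\<^sup>2"
  using orth_proj_orthogonal[OF assms orth_proj_in[OF assms], of x x]
  by (simp add: inner_diff_left inner_diff_right power2_norm_eq_inner inner_commute)

lemma norm_orth_proj_le:
  assumes "subspace V"
  shows "(norm (orth_proj V x))\<^sup>2 \<le> (norm x)\<^sup>2" "(norm (x - orth_proj V x))\<^sup>2 \<le> (norm x)\<^sup>2"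
  using norm_orth_proj_residual[OF assms, of x] by auto

text \<open>The moment generating function at \<open>a\<close> of \<open>Z - x\<close>, for \<open>Z\<close> a random sign of mean \<open>x\<close>, divided by
  the Gaussian bound \<open>exp (a\<^sup>2 / 2)\<close>.\<close>

definition two_point_excess :: "real \<Rightarrow> real \<Rightarrow> real" where
  "two_point_excess x a = (cosh a + x * sinh a) * exp (- a * x - a\<^sup>2 / 2)"

section \<open>The moment generating function of a random sign\<close>

lemma cosh_sinh_pos:
  fixes x a :: real assumes "\<bar>x\<bar> \<le> 1" shows "cosh a + x * sinh a > 0"
proof -
  have "cosh a + x * sinh a = ((1 + x) * exp a + (1 - x) * exp (- a)) / 2"
    by (simp add: cosh_def sinh_def field_simps)
  moreover have "(1 + x) * exp a + (1 - x) * exp (- a) > 0"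
  proof (cases "x = 1")
    case False
    then have "0 < (1 - x) * exp (- a)" using assms by simp
    moreover have "0 \<le> (1 + x) * exp a" using assms by simp
    ultimately show ?thesis by linarith
  qed simp
  ultimately show ?thesis by simp
qed

lemma two_point_excess_nonneg: "\<bar>x\<bar> \<le> 1 \<Longrightarrow> two_point_excess x a \<ge> 0"
  using cosh_sinh_pos[of x a] by (simp add: two_point_excess_def)

lemma two_point_excess_uminus: "two_point_excess (- x) (- a) = two_point_excess x a"
  by (simp add: two_point_excess_def)

text \<open>The logarithm \<open>\<psi>\<close> of the excess is concave with critical point 0, so
  moving away from 0 lowers it. For \<open>a \<ge> 0\<close> its slope at \<open>a\<close> is at
  least \<open>- a\<close>, so by concavity moving back by \<open>\<bar>g\<bar>\<close> raises it by
  at most \<open>- a * g\<close>. Negative \<open>a\<close> follows from the symmetry under changing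
  all signs.\<close>

lemma two_point_excess_add:
  assumes x: "\<bar>x\<bar> \<le> 1"
  shows "a * g \<ge> 0 \<Longrightarrow> two_point_excess x (a + g) \<le> two_point_excess x a"
    and "a * g \<le> 0 \<Longrightarrow> two_point_excess x (a + g) \<le> two_point_excess x a * exp (- a * g)"
proof -
  have nonneg: "(g \<ge> 0 \<longrightarrow> two_point_excess x (a + g) \<le> two_point_excess x a)
     \<and> (g \<le> 0 \<longrightarrow> two_point_excess x (a + g) \<le> two_point_excess x a * exp (- a * g))"
    if x: "\<bar>x\<bar> \<le> 1" and a: "a \<ge> 0" for x a g :: real
  proof -
    define \<psi> where "\<psi> = (\<lambda>a. ln (cosh a + x * sinh a) - a * x - a\<^sup>2 / 2)"
    define \<psi>' where "\<psi>' = (\<lambda>a. (sinh a + x * cosh a) / (cosh a + x * sinh a) - x - a)"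
    have ex: "two_point_excess x a = exp (\<psi> a)" for a
    proof -
      have "exp (\<psi> a) = exp (ln (cosh a + x * sinh a)) * exp (- a * x - a\<^sup>2 / 2)"
        unfolding \<psi>_def exp_add[symmetric] by (simp add: algebra_simps)
      then show ?thesis using cosh_sinh_pos[OF x, of a] by (simp add: two_point_excess_def)
    qed
    have d1: "(\<psi> has_real_derivative \<psi>' a) (at a)" for a
      unfolding \<psi>_def \<psi>'_def using cosh_sinh_pos[OF x, of a]
      by (auto intro!: derivative_eq_intros)
    have d2: "(\<psi>' has_real_derivative - ((sinh a + x * cosh a) / (cosh a + x * sinh a))\<^sup>2) (at a)" for a
    proof -
      let ?N = "sinh a + x * cosh a" and ?M = "cosh a + x * sinh a"
      have pos: "?M > 0" by (rule cosh_sinh_pos[OF x])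
      have "((\<lambda>a. (sinh a + x * cosh a) / (cosh a + x * sinh a)) has_real_derivative
          (?M * ?M - ?N * ?N) / (?M * ?M)) (at a)"
        by (rule DERIV_divide) (use pos in \<open>auto intro!: derivative_eq_intros\<close>)
      then have "(\<psi>' has_real_derivative (?M * ?M - ?N * ?N) / (?M * ?M) - 0 - 1) (at a)"
        unfolding \<psi>'_def by (intro DERIV_diff DERIV_const DERIV_ident)
      also have "(?M * ?M - ?N * ?N) / (?M * ?M) - 0 - 1 = - (?N / ?M)\<^sup>2"
        using pos by (simp add: power2_eq_square diff_divide_distrib)
      finally show ?thesis .
    qed
    have anti: "\<psi>' t \<le> \<psi>' s" if "s \<le> t" for s t
      by (rule DERIV_nonpos_imp_nonincreasing[OF that, of \<psi>'], intro exI conjI, rule d2, simp)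
    have p0: "\<psi>' 0 = 0" by (simp add: \<psi>'_def)
    \<comment> \<open>The quotient in \<open>\<psi>'\<close> is the mean of the sign after
      exponential tilting by \<open>a\<close>; tilting with \<open>a \<ge> 0\<close> cannot push it
      below the original mean \<open>x\<close>.\<close>
    have low: "\<psi>' a \<ge> - a"
    proof -
      have "x\<^sup>2 \<le> 1" using x by (simp add: abs_square_le_1)
      then have "x * (x * sinh a) \<le> 1 * sinh a"
        unfolding mult.assoc[symmetric] power2_eq_square[symmetric] using a by (intro mult_right_mono) auto
      then have "x * (cosh a + x * sinh a) \<le> sinh a + x * cosh a" by (simp add: algebra_simps)
      then show ?thesis using cosh_sinh_pos[OF x, of a] by (simp add: \<psi>'_def pos_le_divide_eq)
    qed
    have 1: "\<psi> (a + g) \<le> \<psi> a" if "g \<ge> 0"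
    proof (rule DERIV_nonpos_imp_nonincreasing[of a "a + g" \<psi>])
      fix y assume "a \<le> y"
      then have "\<psi>' y \<le> 0" using anti[of 0 y] p0 a by simp
      with d1 show "\<exists>l. (\<psi> has_real_derivative l) (at y) \<and> l \<le> 0" by blast
    qed (use that in simp)
    have 2: "\<psi> (a + g) \<le> \<psi> a - a * g" if g: "g < 0"
    proof -
      obtain z where z: "a + g < z" "z < a" "\<psi> a - \<psi> (a + g) = (a - (a + g)) * \<psi>' z"
        using MVT2[of "a + g" a \<psi> \<psi>'] g d1 by auto
      have "\<psi>' z \<ge> - a" using anti[of z a] low z by simp
      then have "(- g) * \<psi>' z \<ge> (- g) * (- a)" using g by (intro mult_left_mono) auto
      then show ?thesis using z(3) by (simp add: algebra_simps)
    qed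
    have "two_point_excess x (a + g) \<le> two_point_excess x a * exp (- a * g)" if "g \<le> 0"
      using that 1 2 unfolding ex exp_add[symmetric] by (cases "g = 0") auto
    then show ?thesis using 1 by (simp add: ex)
  qed
  have "(a * g \<ge> 0 \<longrightarrow> two_point_excess x (a + g) \<le> two_point_excess x a)
     \<and> (a * g \<le> 0 \<longrightarrow> two_point_excess x (a + g) \<le> two_point_excess x a * exp (- a * g))"
  proof (cases a "0::real" rule: linorder_cases)
    case less
    then show ?thesis
      using nonneg[of "- x" "- a" "- g"] x two_point_excess_uminus[of x a] two_point_excess_uminus[of x "a + g"]
      by (auto simp: zero_le_mult_iff mult_le_0_iff)
  next
    case equal
    then show ?thesis
      using nonneg[OF x, of 0 g] nonneg[of "- x" 0 "- g"] x two_point_excess_uminus[of x 0] two_point_excess_uminus[of x g]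
      by (cases "g \<ge> 0") auto
  next
    case greater
    then show ?thesis using nonneg[OF x, of a g] by (auto simp: zero_le_mult_iff mult_le_0_iff)
  qed
  then show "a * g \<ge> 0 \<Longrightarrow> two_point_excess x (a + g) \<le> two_point_excess x a"
    "a * g \<le> 0 \<Longrightarrow> two_point_excess x (a + g) \<le> two_point_excess x a * exp (- a * g)" by auto
qed

text \<open>Hoeffding's lemma for a random sign of mean \<open>x\<close>: the excess is 1 at
  \<open>a = 0\<close> and does not increase away from there.\<close>

lemma two_point_excess_le_1: "\<bar>x\<bar> \<le> 1 \<Longrightarrow> two_point_excess x a \<le> 1"
  using two_point_excess_add(1)[of x 0 a] by (simp add: two_point_excess_def)

lemma two_point_excess_sign:
  assumes "\<bar>x\<bar> = 1" shows "two_point_excess x a = exp (- (a\<^sup>2 / 2))"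
proof -
  have "x = 1 \<or> x = -1" using assms by linarith
  then show ?thesis
    by (auto simp: two_point_excess_def cosh_plus_sinh cosh_minus_sinh simp flip: exp_add)
qed

text \<open>The exponential factor cancels the dependence on \<open>d\<close> in the normalisation,
  leaving the moment generating function, which is affine in the mean. Hence moving the pivot in one
  of the two directions does not increase a weighted sum of such terms.\<close>

lemma exp_two_point_excess_affine:
  "exp (d * a) * two_point_excess (x + d) a
     = two_point_excess x a + d * (sinh a * exp (- a * x - a\<^sup>2 / 2))"
proof -
  have "exp (d * a) * exp (- a * (x + d) - a\<^sup>2 / 2) = exp (- a * x - a\<^sup>2 / 2)"
    unfolding exp_add[symmetric] by (simp add: algebra_simps)
  then have "exp (d * a) * two_point_excess (x + d) a
      = (cosh a + (x + d) * sinh a) * exp (- a * x - a\<^sup>2 / 2)"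
    unfolding two_point_excess_def by (metis mult.left_commute)
  then show ?thesis by (simp add: two_point_excess_def algebra_simps)
qed

section \<open>Energy released when coordinates freeze\<close>

text \<open>The competitor \<open>?y\<close> adds to the projection onto \<open>U\<close> a multiple
  of \<open>r\<close>, which is orthogonal to \<open>U\<close> and has norm at most 1. The loss
  \<open>(r \<bullet> v)\<^sup>2\<close> pays for the pivot's factor in
  \<open>two_point_excess_sign\<close>.\<close>

lemma energy_freeze_pivot:
  assumes U: "subspace U" and V: "subspace V" "U \<subseteq> V" "w \<in> V" and w: "norm w \<le> 1"
    and r: "r = w - orth_proj U w"
  shows "(norm (orth_proj U v))\<^sup>2 + (r \<bullet> v)\<^sup>2 \<le> (norm (orth_proj V v))\<^sup>2"
proof -
  let ?y = "orth_proj U v + (r \<bullet> v) *\<^sub>R r"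
  have y: "orth_proj U v \<in> U" by (rule orth_proj_in[OF U])
  have ry: "r \<bullet> orth_proj U v = 0" unfolding r by (rule orth_proj_orthogonal[OF U y])
  have "r \<in> V" unfolding r using V orth_proj_in[OF U, of w] by (auto intro: subspace_diff)
  then have "?y \<in> V" using V y by (auto intro: subspace_add subspace_scale)
  have rr: "(norm r)\<^sup>2 \<le> 1" unfolding r
    using norm_orth_proj_le(2)[OF U, of w] w by (smt (verit) norm_ge_zero power_le_one)
  have "(norm ?y)\<^sup>2 = (norm (orth_proj U v))\<^sup>2 + (r \<bullet> v)\<^sup>2 * (norm r)\<^sup>2"
    unfolding power2_norm_eq_inner using ry
    by (simp add: inner_add_left inner_add_right inner_commute power2_eq_square algebra_simps)
  moreover have "(r \<bullet> v)\<^sup>2 * (norm r)\<^sup>2 \<le> (r \<bullet> v)\<^sup>2" using rr by (intro mult_left_le) auto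
  moreover have "2 * (v \<bullet> ?y) = 2 * (v \<bullet> orth_proj U v) + 2 * (r \<bullet> v)\<^sup>2"
    by (simp add: inner_add_right inner_commute power2_eq_square)
  ultimately show ?thesis
    using norm_orth_proj_ge[OF V(1) \<open>?y \<in> V\<close>, of v] norm_orth_proj_eq[OF U, of v] by linarith
qed

text \<open>Shrinking \<open>U\<close> to \<open>U'\<close> changes the residual of the pivot by a
  vector \<open>\<rho>\<close> of \<open>U\<close>, orthogonal to \<open>r\<close>. If this moves
  \<open>a\<close> away from 0, both factors decrease. Otherwise the excess can grow by
  \<open>exp (- a * g)\<close>, which is paid for by the energy of \<open>v\<close> in a direction
  of \<open>V\<close> orthogonal to \<open>V'\<close>.\<close>

lemma energy_freeze_others:
  assumes U: "subspace U" "subspace U'" "U' \<subseteq> U" and w: "norm w \<le> 1" and x: "\<bar>x\<bar> \<le> 1"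
    and r: "r = w - orth_proj U w" "r' = w - orth_proj U' w"
  shows "two_point_excess x (r' \<bullet> v) * exp ((norm (orth_proj (span (insert w U')) v))\<^sup>2 / 2)
    \<le> two_point_excess x (r \<bullet> v) * exp ((norm (orth_proj (span (insert w U)) v))\<^sup>2 / 2)"
proof -
  define V V' where "V = span (insert w U)" and "V' = span (insert w U')"
  have V: "subspace V" "subspace V'" "V' \<subseteq> V" "w \<in> V" "U \<subseteq> V"
    unfolding V_def V'_def using span_mono[of "insert w U'" "insert w U"] U(3) by (auto intro: span_base)
  define \<rho> where "\<rho> = r' - r"
  define a g where "a = r \<bullet> v" and "g = \<rho> \<bullet> v"
  have r'v: "r' \<bullet> v = a + g" by (simp add: a_def g_def \<rho>_def inner_diff_left)
  have mono: "(norm (orth_proj V' v))\<^sup>2 \<le> (norm (orth_proj V v))\<^sup>2"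
    by (rule norm_orth_proj_mono) (use V in auto)
  have "two_point_excess x (a + g) * exp ((norm (orth_proj V' v))\<^sup>2 / 2)
     \<le> two_point_excess x a * exp ((norm (orth_proj V v))\<^sup>2 / 2)"
  proof (cases "a * g \<ge> 0")
    case True
    show ?thesis
      by (intro mult_mono two_point_excess_add(1)[OF x True] two_point_excess_nonneg[OF x]) (use mono in auto)
  next
    case False
    define R S where "R = (norm r)\<^sup>2" and "S = (norm \<rho>)\<^sup>2"
    have "a \<noteq> 0" "g \<noteq> 0" using False by auto
    then have RS: "R > 0" "S > 0" by (auto simp: R_def S_def a_def g_def)
    have \<rho>U: "\<rho> \<in> U" unfolding \<rho>_def r
      using orth_proj_in[OF U(1), of w] orth_proj_in[OF U(2), of w] U
      by (auto intro!: subspace_diff)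
    have r_perp: "r \<bullet> y = 0" if "y \<in> U" for y unfolding r by (rule orth_proj_orthogonal[OF U(1) that])
    have r'_perp: "r' \<bullet> y = 0" if "y \<in> U'" for y unfolding r by (rule orth_proj_orthogonal[OF U(2) that])
    have r'_eq: "r' = r + \<rho>" by (simp add: \<rho>_def)
    have r\<rho>: "r \<bullet> \<rho> = 0" by (rule r_perp[OF \<rho>U])
    have "(norm r')\<^sup>2 = R + S" unfolding r'_eq R_def S_def power2_norm_eq_inner
      using r\<rho> by (simp add: inner_add_left inner_add_right inner_commute)
    then have RS1: "R + S \<le> 1" using norm_orth_proj_le(2)[OF U(2), of w] w unfolding r
      by (smt (verit) norm_ge_zero power_le_one)
    \<comment> \<open>The combination of \<open>r\<close> and \<open>\<rho>\<close> orthogonal to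
      \<open>r' = r + \<rho>\<close>. It is also orthogonal to \<open>U'\<close>, hence to
      \<open>w\<close> and to all of \<open>V'\<close>.\<close>
    define d where "d = S *\<^sub>R r - R *\<^sub>R \<rho>"
    have rV: "r \<in> V" unfolding r using V orth_proj_in[OF U(1), of w] by (auto intro: subspace_diff)
    have dV: "d \<in> V" unfolding d_def using rV \<rho>U V by (auto intro!: subspace_diff subspace_scale)
    have dr': "d \<bullet> r' = 0" unfolding d_def r'_eq using r\<rho> inner_commute[of \<rho> r]
      by (simp add: inner_diff_left inner_add_right R_def S_def power2_norm_eq_inner)
    have dU': "d \<bullet> y = 0" if "y \<in> U'" for y
      unfolding d_def \<rho>_def using r_perp r'_perp[OF that] that U(3) by (auto simp: inner_diff_left)
    have "w = r' + orth_proj U' w" by (simp add: r)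
    then have "d \<bullet> w = 0" using dr' dU'[OF orth_proj_in[OF U(2)]] by (metis add_0 inner_add_right)
    then have d_perp: "orthogonal d y" if "y \<in> V'" for y
      using that unfolding V'_def by (rule_tac orthogonal_to_span) (auto simp: orthogonal_def dU')
    let ?w = "orth_proj V' v"
    have wV': "?w \<in> V'" by (rule orth_proj_in[OF V(2)])
    \<comment> \<open>This is \<open>(v \<bullet> d) / (norm d)\<^sup>2\<close>, the coefficient of
      the projection of \<open>v\<close> to the line of \<open>d\<close>, which maximises the
      gain.\<close>
    define s where "s = (S * a - R * g) / (R * S * (R + S))"
    let ?y = "?w + s *\<^sub>R d"
    have "?y \<in> V" using wV' dV V by (auto intro: subspace_add subspace_scale)
    have dd: "(norm d)\<^sup>2 = R * S * (R + S)"
      unfolding d_def power2_norm_eq_inner using r\<rho>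
      by (simp add: inner_diff_left inner_diff_right inner_commute R_def S_def power2_norm_eq_inner algebra_simps)
    have vd: "v \<bullet> d = S * a - R * g"
      by (simp add: d_def a_def g_def inner_diff_right inner_commute)
    have "(norm ?y)\<^sup>2 = (norm ?w)\<^sup>2 + s\<^sup>2 * (norm d)\<^sup>2"
      unfolding power2_norm_eq_inner using d_perp[OF wV']
      by (simp add: inner_add_left inner_add_right inner_commute orthogonal_def power2_eq_square algebra_simps)
    moreover have "2 * (v \<bullet> ?y) = 2 * (v \<bullet> ?w) + 2 * s * (v \<bullet> d)"
      by (simp add: inner_add_right)
    ultimately have gain: "(norm ?w)\<^sup>2 + (2 * s * (S * a - R * g) - s\<^sup>2 * (R * S * (R + S))) \<le> (norm (orth_proj V v))\<^sup>2"
      using norm_orth_proj_ge[OF V(1) \<open>?y \<in> V\<close>, of v] norm_orth_proj_eq[OF V(2), of v] unfolding dd vd by linarith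
    have "2 * s * (S * a - R * g) - s\<^sup>2 * (R * S * (R + S)) = (S * a - R * g)\<^sup>2 / (R * S * (R + S))"
    proof -
      have aux: "2 * (m / Q) * m - (m / Q)\<^sup>2 * Q = m\<^sup>2 / Q" if "Q \<noteq> 0" for m Q :: real
        using that by (simp add: power2_eq_square field_simps)
      show ?thesis unfolding s_def by (rule aux) (use RS in simp)
    qed
    moreover have "2 * (- a * g) \<le> (S * a - R * g)\<^sup>2 / (R * S * (R + S))"
    proof -
      \<comment> \<open>Here \<open>norm w \<le> 1\<close> is used, through
        \<open>R + S \<le> 1\<close>; after that, the two squares in the expansion are simply
        dropped.\<close>
      have "2 * (- a * g) * (R * S * (R + S)) \<le> 2 * (- a * g) * (R * S)"
        using False RS RS1 by (intro mult_left_mono mult_left_le) auto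
      also have "\<dots> \<le> (S * a)\<^sup>2 + (R * g)\<^sup>2 - 2 * (S * a) * (R * g)" by simp
      also have "\<dots> = (S * a - R * g)\<^sup>2" by (simp add: power2_diff)
      finally show ?thesis using RS by (simp add: pos_le_divide_eq)
    qed
    ultimately have "- a * g + (norm ?w)\<^sup>2 / 2 \<le> (norm (orth_proj V v))\<^sup>2 / 2" using gain by linarith
    then have "exp (- a * g) * exp ((norm ?w)\<^sup>2 / 2) \<le> exp ((norm (orth_proj V v))\<^sup>2 / 2)"
      unfolding exp_add[symmetric] by simp
    then have "two_point_excess x a * (exp (- a * g) * exp ((norm ?w)\<^sup>2 / 2))
        \<le> two_point_excess x a * exp ((norm (orth_proj V v))\<^sup>2 / 2)"
      by (intro mult_left_mono two_point_excess_nonneg[OF x])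
    moreover have "two_point_excess x (a + g) \<le> two_point_excess x a * exp (- a * g)"
      by (rule two_point_excess_add(2)[OF x]) (use False in simp)
    then have "two_point_excess x (a + g) * exp ((norm ?w)\<^sup>2 / 2)
       \<le> two_point_excess x a * exp (- a * g) * exp ((norm ?w)\<^sup>2 / 2)" by (intro mult_right_mono) auto
    ultimately show ?thesis unfolding mult.assoc by (rule order_trans[rotated])
  qed
  then show ?thesis unfolding r'v unfolding a_def V_def V'_def .
qed

text \<open>The coefficients are indexed by \<open>S\<close> and not by the image, since different
  indices may carry the same vector.\<close>

lemma in_span_image_imp_sum:
  assumes "finite S" "y \<in> span (g ` S)"
  shows "\<exists>f. y = (\<Sum>j\<in>S. f j *\<^sub>R g j)"
  using assms
proof (induction S arbitrary: y rule: finite_induct)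
  case (insert i S)
  then obtain k where "y - k *\<^sub>R g i \<in> span (g ` S)" by (auto simp: span_breakdown_eq)
  with insert obtain f where f: "y - k *\<^sub>R g i = (\<Sum>j\<in>S. f j *\<^sub>R g j)" by blast
  have "y = k *\<^sub>R g i + (\<Sum>j\<in>S. f j *\<^sub>R g j)" using f by (simp add: algebra_simps)
  also have "\<dots> = (\<Sum>j\<in>insert i S. (if j = i then k else f j) *\<^sub>R g j)"
  proof -
    have "(\<Sum>j\<in>S. f j *\<^sub>R g j) = (\<Sum>j\<in>S. (if j = i then k else f j) *\<^sub>R g j)"
      by (rule sum.cong) (use insert.hyps in auto)
    then show ?thesis using insert.hyps by simp
  qed
  finally show ?case by (rule exI[of _ "\<lambda>j. if j = i then k else f j"])
qed simp

lemma span_insert_span: "span (insert a (span S)) = span (insert a S)"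
proof (intro subset_antisym span_minimal subspace_span)
  show "insert a (span S) \<subseteq> span (insert a S)"
    using span_mono[of S "insert a S"] by (auto intro: span_base)
  show "insert a S \<subseteq> span (insert a (span S))"
    by (auto intro: span_base)
qed

section \<open>The derandomised walk\<close>

definition alive :: "real ^ 'n \<Rightarrow> 'n set" where
  "alive x = {j. \<bar>x $ j\<bar> < 1}"

text \<open>Each moving coordinate \<open>j\<close> reaches the face of the cube it heads for at
  time \<open>f j\<close>; \<open>d\<close> is the earliest of these times.\<close>

lemma move_until_frozen:
  fixes x u :: "real ^ 'n"
  assumes cube: "\<And>j. \<bar>x $ j\<bar> \<le> 1" and supp: "\<And>j. j \<notin> alive x \<Longrightarrow> u $ j = 0" and u: "u $ p \<noteq> 0"
  obtains d where "d > 0" "\<And>j. \<bar>(x + d *\<^sub>R u) $ j\<bar> \<le> 1" "alive (x + d *\<^sub>R u) \<subset> alive x"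
proof -
  define J where "J = {j. u $ j \<noteq> 0}"
  define f where "f j = (1 - sgn (u $ j) * x $ j) / \<bar>u $ j\<bar>" for j
  define d where "d = Min (f ` J)"
  have J: "finite J" "J \<noteq> {}" using u by (auto simp: J_def)
  have fpos: "f j > 0" if "j \<in> J" for j
  proof -
    have "\<bar>x $ j\<bar> < 1" using that supp[of j] by (auto simp: J_def alive_def)
    then have "1 - sgn (u $ j) * x $ j > 0" by (auto simp: sgn_if)
    then show ?thesis using that by (auto simp: f_def J_def)
  qed
  have dle: "d \<le> f j" if "j \<in> J" for j using that J by (simp add: d_def)
  obtain i where i: "i \<in> J" "d = f i" using Min_in[of "f ` J"] J unfolding d_def by (metis finite_imageI image_iff image_is_empty)
  have dpos: "d > 0" using fpos i by simp
  have in_cube: "\<bar>(x + d *\<^sub>R u) $ j\<bar> \<le> 1" for j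
  proof (cases "j \<in> J")
    case True
    then have "d * \<bar>u $ j\<bar> \<le> 1 - sgn (u $ j) * x $ j"
      using dle[OF True] by (simp add: f_def J_def pos_le_divide_eq)
    moreover have "d * \<bar>u $ j\<bar> \<ge> 0" using dpos by simp
    ultimately show ?thesis using cube[of j] True
      by (cases "u $ j > 0") (auto simp: sgn_if J_def abs_if split: if_splits)
  qed (use cube in \<open>simp add: J_def\<close>)
  have "\<bar>(x + d *\<^sub>R u) $ i\<bar> = 1"
  proof -
    have "d * \<bar>u $ i\<bar> = 1 - sgn (u $ i) * x $ i" using i by (simp add: f_def J_def)
    then show ?thesis using i(1) by (cases "u $ i > 0") (auto simp: sgn_if J_def)
  qed
  moreover have "i \<in> alive x" using i supp[of i] by (auto simp: J_def)
  moreover have "alive (x + d *\<^sub>R u) \<subseteq> alive x"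
  proof
    fix j assume "j \<in> alive (x + d *\<^sub>R u)"
    then show "j \<in> alive x" using supp[of j] by (cases "j \<in> alive x") (auto simp: alive_def)
  qed
  moreover have "i \<notin> alive (x + d *\<^sub>R u)"
    using \<open>\<bar>(x + d *\<^sub>R u) $ i\<bar> = 1\<close> by (simp add: alive_def)
  ultimately have "alive (x + d *\<^sub>R u) \<subset> alive x" by blast
  then show thesis using that dpos in_cube by blast
qed

text \<open>Induction on the number of fractional coordinates, with arbitrary weights
  \<open>c\<close> so that the exponential factors of moves already made can be absorbed.\<close>

lemma gram_schmidt_walk:
  fixes x :: "real ^ 'n" and w :: "'n \<Rightarrow> 'a::euclidean_space" and v :: "'k::finite \<Rightarrow> 'a"
  defines "S \<equiv> \<lambda>x :: real ^ 'n. \<Sum>j\<in>UNIV. x $ j *\<^sub>R w j"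
    and "E \<equiv> \<lambda>J v. exp ((norm (orth_proj (span (w ` J)) v))\<^sup>2 / 2)"
  assumes w: "\<And>j. norm (w j) \<le> 1" and cube: "\<And>j. \<bar>x $ j\<bar> \<le> 1" and c: "\<And>k. c k \<ge> 0"
  shows "\<exists>z. (\<forall>j. z $ j \<in> {-1, 1}) \<and>
         (\<Sum>k\<in>UNIV. c k * exp ((S z - S x) \<bullet> v k)) \<le> (\<Sum>k\<in>UNIV. c k * E (alive x) (v k))"
proof -
  define res where "res = (\<lambda>J p. w p - orth_proj (span (w ` (J - {p}))) (w p))"
  \<comment> \<open>The first conjunct, sharper by the pivot's factor, is for continuing with a
    pivot that is still fractional; the second is for when the pivot has frozen.\<close>
  have "(\<forall>p \<in> alive x. \<exists>z. (\<forall>j. z $ j \<in> {-1, 1}) \<and>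
         (\<Sum>k\<in>UNIV. c k * exp ((S z - S x) \<bullet> v k))
           \<le> (\<Sum>k\<in>UNIV. c k * (two_point_excess (x $ p) (res (alive x) p \<bullet> v k) * E (alive x) (v k)))) \<and>
      (\<exists>z. (\<forall>j. z $ j \<in> {-1, 1}) \<and>
         (\<Sum>k\<in>UNIV. c k * exp ((S z - S x) \<bullet> v k)) \<le> (\<Sum>k\<in>UNIV. c k * E (alive x) (v k)))"
    using cube c
  proof (induction "card (alive x)" arbitrary: x c rule: less_induct)
    case less
    note cube = less.prems(1) and c = less.prems(2)
    have pivot: "\<exists>z. (\<forall>j. z $ j \<in> {-1, 1}) \<and>
         (\<Sum>k\<in>UNIV. c k * exp ((S z - S x) \<bullet> v k))
           \<le> (\<Sum>k\<in>UNIV. c k * (two_point_excess (x $ p) (res (alive x) p \<bullet> v k) * E (alive x) (v k)))"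
      if p: "p \<in> alive x" for p
    proof -
      define J where "J = alive x"
      define r where "r = res J p"
      define V where "V = span (w ` J)"
      define U where "U = span (w ` (J - {p}))"
      define \<alpha> where "\<alpha> k = r \<bullet> v k" for k
      have VU: "V = span (insert (w p) U)"
        unfolding V_def U_def span_insert_span using p by (simp add: J_def insert_absorb flip: image_insert)
      have "orth_proj U (w p) \<in> U" by (rule orth_proj_in) (simp add: U_def)
      then obtain f where f: "orth_proj U (w p) = (\<Sum>j\<in>J - {p}. f j *\<^sub>R w j)"
        using in_span_image_imp_sum[of "J - {p}" _ w] unfolding U_def by auto
      \<comment> \<open>The pivot moves at unit speed and the others cancel the part of its vector
        in their span, so \<open>S u\<close> is the residual \<open>r\<close>.\<close>
      define u :: "real ^ 'n" where "u = (\<chi> j. if j = p then 1 else if j \<in> J then - f j else 0)"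
      have up: "u $ p = 1" by (simp add: u_def)
      have u0: "u $ j = 0" if "j \<notin> alive x" for j using that p by (auto simp: u_def J_def)
      have Su: "S u = r"
      proof -
        have "S u = (\<Sum>j\<in>insert p (J - {p}). u $ j *\<^sub>R w j)"
          unfolding S_def by (rule sum.mono_neutral_right) (auto simp: u_def)
        also have "\<dots> = w p + (\<Sum>j\<in>J - {p}. - (f j *\<^sub>R w j))"
          by (subst sum.insert) (auto simp: u_def intro!: sum.cong)
        finally show ?thesis by (simp add: r_def res_def f[unfolded U_def] sum_negf U_def)
      qed
      have S_lin: "S (x + d *\<^sub>R u) = S x + d *\<^sub>R r" for d
        unfolding Su[symmetric] by (simp add: S_def scaleR_add_left sum.distrib scaleR_sum_right)
      \<comment> \<open>The bound guaranteed by the induction hypothesis after a move by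
        \<open>d\<close>. It is affine in \<open>d\<close>, and \<open>G 0\<close> is the bound to
        be shown.\<close>
      define G where "G d = (\<Sum>k\<in>UNIV. c k * (exp (d * \<alpha> k) * two_point_excess (x $ p + d) (\<alpha> k) * E J (v k)))" for d
      have step: "\<exists>z. (\<forall>j. z $ j \<in> {-1, 1}) \<and> (\<Sum>k\<in>UNIV. c k * exp ((S z - S x) \<bullet> v k)) \<le> G d"
        if cube': "\<And>j. \<bar>(x + d *\<^sub>R u) $ j\<bar> \<le> 1" and sub: "alive (x + d *\<^sub>R u) \<subset> J" for d
      proof -
        define y where "y = x + d *\<^sub>R u"
        define c' where "c' k = c k * exp (d * \<alpha> k)" for k
        have c': "c' k \<ge> 0" for k using c by (simp add: c'_def)
        have card: "card (alive y) < card (alive x)"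
          using sub by (intro psubset_card_mono) (auto simp: y_def J_def)
        note IH = less.hyps[OF card cube'[folded y_def] c']
        have yp: "y $ p = x $ p + d" by (simp add: y_def up)
        have "\<bar>y $ p\<bar> \<le> 1" using cube' by (simp add: y_def)
        have ex: "\<exists>z. (\<forall>j. z $ j \<in> {-1, 1}) \<and>
            (\<Sum>k\<in>UNIV. c' k * exp ((S z - S y) \<bullet> v k)) \<le> (\<Sum>k\<in>UNIV. c' k * (two_point_excess (y $ p) (\<alpha> k) * E J (v k)))"
        proof (cases "p \<in> alive y")
          case True
          \<comment> \<open>The pivot survives and is kept: its residual changes because other
            coordinates froze.\<close>
          define U' where "U' = span (w ` (alive y - {p}))"
          have eq: "span (w ` alive y) = span (insert (w p) U')"
            unfolding U'_def span_insert_span using True by (simp add: insert_absorb flip: image_insert)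
          have "U' \<subseteq> U" unfolding U'_def U_def by (rule span_mono) (use sub in \<open>auto simp: y_def\<close>)
          then have le: "two_point_excess (y $ p) (res (alive y) p \<bullet> v k) * E (alive y) (v k)
              \<le> two_point_excess (y $ p) (\<alpha> k) * E J (v k)" for k
            unfolding E_def eq V_def[symmetric] VU \<alpha>_def
            by (intro energy_freeze_others[of U U'] w)
               (use \<open>\<bar>y $ p\<bar> \<le> 1\<close> in \<open>auto simp: r_def res_def U_def U'_def\<close>)
          have "(\<Sum>k\<in>UNIV. c' k * (two_point_excess (y $ p) (res (alive y) p \<bullet> v k) * E (alive y) (v k)))
             \<le> (\<Sum>k\<in>UNIV. c' k * (two_point_excess (y $ p) (\<alpha> k) * E J (v k)))"
            by (intro sum_mono mult_left_mono le c')
          with IH True show ?thesis by (meson order_trans)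
        next
          case False
          then have "\<bar>y $ p\<bar> = 1" using \<open>\<bar>y $ p\<bar> \<le> 1\<close> by (auto simp: alive_def)
          \<comment> \<open>The pivot is now a sign, so its factor is a pure Gaussian
            \<open>exp (- (\<alpha> k)\<^sup>2 / 2)\<close>, covered by the energy lost with its
            direction.\<close>
          have le: "E (alive y) (v k) \<le> two_point_excess (y $ p) (\<alpha> k) * E J (v k)" for k
          proof -
            have "(norm (orth_proj (span (w ` alive y)) (v k)))\<^sup>2 \<le> (norm (orth_proj U (v k)))\<^sup>2"
              unfolding U_def
              by (rule norm_orth_proj_mono) (use sub False in \<open>auto simp: y_def intro!: span_mono\<close>)
            also have "\<dots> + (\<alpha> k)\<^sup>2 \<le> (norm (orth_proj V (v k)))\<^sup>2"
              unfolding \<alpha>_def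
              by (rule energy_freeze_pivot[of U V "w p"])
                 (auto simp: VU span_base w r_def res_def U_def intro: subsetD[OF span_superset])
            finally show ?thesis unfolding two_point_excess_sign[OF \<open>\<bar>y $ p\<bar> = 1\<close>] E_def V_def[symmetric]
              by (simp flip: exp_add)
          qed
          have "(\<Sum>k\<in>UNIV. c' k * E (alive y) (v k))
             \<le> (\<Sum>k\<in>UNIV. c' k * (two_point_excess (y $ p) (\<alpha> k) * E J (v k)))"
            by (intro sum_mono mult_left_mono le c')
          with IH show ?thesis by (meson order_trans)
        qed
        have e1: "c' k * exp ((S z - S y) \<bullet> v k) = c k * exp ((S z - S x) \<bullet> v k)" for k z
          unfolding y_def S_lin c'_def \<alpha>_def mult.assoc exp_add[symmetric]
          by (simp add: inner_diff_left inner_add_left)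
        have e2: "c' k * (two_point_excess (y $ p) (\<alpha> k) * E J (v k))
            = c k * (exp (d * \<alpha> k) * two_point_excess (x $ p + d) (\<alpha> k) * E J (v k))" for k
          by (simp add: c'_def yp)
        show ?thesis using ex unfolding e1 e2 G_def .
      qed
      \<comment> \<open>The slope of \<open>G\<close>; its sign decides which way to move along
        \<open>u\<close> until a coordinate freezes.\<close>
      define \<kappa> where "\<kappa> = (\<Sum>k\<in>UNIV. c k * (sinh (\<alpha> k) * exp (- \<alpha> k * x $ p - (\<alpha> k)\<^sup>2 / 2) * E J (v k)))"
      have G: "G d = G 0 + d * \<kappa>" for d
        unfolding G_def exp_two_point_excess_affine \<kappa>_def sum_distrib_left
        by (simp add: sum.distrib[symmetric] algebra_simps)
      have "\<exists>d. d * \<kappa> \<le> 0 \<and> (\<forall>j. \<bar>(x + d *\<^sub>R u) $ j\<bar> \<le> 1) \<and> alive (x + d *\<^sub>R u) \<subset> J"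
      proof (cases "\<kappa> \<le> 0")
        case True
        obtain d where "d > 0" "\<And>j. \<bar>(x + d *\<^sub>R u) $ j\<bar> \<le> 1" "alive (x + d *\<^sub>R u) \<subset> alive x"
          using move_until_frozen[of x u p] cube u0 up by auto
        then show ?thesis using True unfolding J_def by (intro exI[of _ d]) (auto simp: mult_nonneg_nonpos)
      next
        case False
        obtain d where "d > 0" "\<And>j. \<bar>(x + d *\<^sub>R (- u)) $ j\<bar> \<le> 1" "alive (x + d *\<^sub>R (- u)) \<subset> alive x"
          using move_until_frozen[of x "- u" p] cube u0 up by auto
        then show ?thesis using False unfolding J_def by (intro exI[of _ "- d"]) auto
      qed
      then obtain d where "d * \<kappa> \<le> 0" and "\<exists>z. (\<forall>j. z $ j \<in> {-1, 1}) \<and> (\<Sum>k\<in>UNIV. c k * exp ((S z - S x) \<bullet> v k)) \<le> G d"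
        using step by blast
      then have "\<exists>z. (\<forall>j. z $ j \<in> {-1, 1}) \<and> (\<Sum>k\<in>UNIV. c k * exp ((S z - S x) \<bullet> v k)) \<le> G 0"
        using G[of d] by (smt (verit))
      then show ?thesis by (simp add: G_def \<alpha>_def r_def J_def)
    qed
    have "\<exists>z. (\<forall>j. z $ j \<in> {-1, 1}) \<and>
         (\<Sum>k\<in>UNIV. c k * exp ((S z - S x) \<bullet> v k)) \<le> (\<Sum>k\<in>UNIV. c k * E (alive x) (v k))"
    proof (cases "alive x = {}")
      case True
      have "x $ j \<in> {-1, 1}" for j
        using True cube[of j] by (auto simp: alive_def abs_if dest: spec[of _ j] split: if_splits)
      moreover have "(\<Sum>k\<in>UNIV. c k * exp ((S x - S x) \<bullet> v k)) \<le> (\<Sum>k\<in>UNIV. c k * E (alive x) (v k))"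
        by (intro sum_mono mult_left_mono c) (simp add: E_def)
      ultimately show ?thesis by blast
    next
      case False
      then obtain p where p: "p \<in> alive x" by blast
      have "two_point_excess (x $ p) a * E (alive x) (v k) \<le> E (alive x) (v k)" for a k
        using mult_right_mono[OF two_point_excess_le_1[OF cube[of p]], of "E (alive x) (v k)" a] by (simp add: E_def)
      then have "(\<Sum>k\<in>UNIV. c k * (two_point_excess (x $ p) (res (alive x) p \<bullet> v k) * E (alive x) (v k)))
          \<le> (\<Sum>k\<in>UNIV. c k * E (alive x) (v k))"
        by (intro sum_mono mult_left_mono c)
      with pivot[OF p] show ?thesis by (meson order_trans)
    qed
    with pivot show ?case by blast
  qed
  then show ?thesis by blast
qed

lemma ln_2_card_nonneg: "ln (2 * real CARD('m::finite)) \<ge> 0"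
proof -
  have "2 * real CARD('m) \<ge> 1" using zero_less_card_finite[where 'a = 'm] by linarith
  then show ?thesis by simp
qed

text \<open>The walk starts at 0 with columns scaled to norm at most 1, tested against
  \<open>l\<close> times the signed unit vectors. Every single exponential is at most the total
  \<open>N * exp (l\<^sup>2 / 2)\<close>.\<close>

lemma banaszczyk_sqrt_log:
  fixes A :: "real ^ 'n ^ 'm"
  assumes col: "\<And>j. norm (column j A) \<le> L"
  shows "\<exists>z :: real ^ 'n. (\<forall>j. z $ j \<in> {-1, 1}) \<and>
    infnorm (A *v z) \<le> L * sqrt (2 * ln (2 * real CARD('m)))"
proof (cases "L > 0")
  case False
  then have "norm (column j A) \<le> 0" for j using col[of j] by linarith
  then have "column j A = 0" for j by simp
  then have "A *v z = 0" for z by (simp add: matrix_mult_sum)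
  moreover have "L \<ge> 0" using col norm_ge_zero order_trans by blast
  moreover have "ln (2 * real CARD('m)) \<ge> 0" using ln_2_card_nonneg .
  ultimately show ?thesis
    by (intro exI[of _ "\<chi> j. 1"]) (auto simp: infnorm_0)
next
  case True
  define N where "N = 2 * real CARD('m)"
  have N: "N \<ge> 2" by (simp add: N_def Suc_le_eq)
  \<comment> \<open>This value minimises \<open>ln N / l + l / 2\<close>, the resulting bound on the
    entries; the minimum is \<open>l\<close> itself.\<close>
  define l where "l = sqrt (2 * ln N)"
  have l: "l > 0" "l\<^sup>2 = 2 * ln N" using N by (simp_all add: l_def)
  define w where "w j = (1 / L) *\<^sub>R column j A" for j
  have w: "norm (w j) \<le> 1" for j using col[of j] True by (simp add: w_def field_simps)
  define v :: "'m \<times> bool \<Rightarrow> real ^ 'm" where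
    "v = (\<lambda>(i, s). (if s then l else - l) *\<^sub>R axis i 1)"
  obtain z :: "real ^ 'n" where z: "\<And>j. z $ j \<in> {-1, 1}" and
    bnd: "(\<Sum>k\<in>UNIV. exp ((\<Sum>j\<in>UNIV. z $ j *\<^sub>R w j) \<bullet> v k))
      \<le> (\<Sum>k\<in>UNIV. exp ((norm (orth_proj (span (w ` alive (0 :: real ^ 'n))) (v k)))\<^sup>2 / 2))"
    using gram_schmidt_walk[of w "0 :: real ^ 'n" "\<lambda>_. 1" v] w by auto
  have Az: "A *v z = L *\<^sub>R (\<Sum>j\<in>UNIV. z $ j *\<^sub>R w j)"
    using True by (simp add: matrix_mult_sum w_def scaleR_sum_right scalar_mult_eq_scaleR)
  define y where "y = (\<Sum>j\<in>UNIV. z $ j *\<^sub>R w j)"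
  have nv: "(norm (v k))\<^sup>2 = l\<^sup>2" for k
    by (cases k) (simp add: v_def)
  have tot: "(\<Sum>k\<in>UNIV. exp (y \<bullet> v k)) \<le> N * exp (l\<^sup>2 / 2)"
  proof -
    have "(norm (orth_proj (span (w ` alive (0 :: real ^ 'n))) (v k)))\<^sup>2 \<le> l\<^sup>2" for k
      using norm_orth_proj_le(1)[of "span (w ` alive (0 :: real ^ 'n))" "v k"] nv by simp
    then have "(\<Sum>k\<in>UNIV. exp ((norm (orth_proj (span (w ` alive (0 :: real ^ 'n))) (v k)))\<^sup>2 / 2))
       \<le> (\<Sum>k\<in>(UNIV :: ('m \<times> bool) set). exp (l\<^sup>2 / 2))"
      by (intro sum_mono) simp
    with bnd show ?thesis by (simp add: y_def N_def)
  qed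
  have le: "y \<bullet> v k \<le> l\<^sup>2" for k
  proof -
    have "exp (y \<bullet> v k) \<le> (\<Sum>k\<in>UNIV. exp (y \<bullet> v k))" by (rule member_le_sum) auto
    also have "\<dots> \<le> exp (ln N) * exp (l\<^sup>2 / 2)" using tot N by simp
    also have "\<dots> = exp (l\<^sup>2)" unfolding exp_add[symmetric] l(2) by simp
    finally show ?thesis by simp
  qed
  have "\<bar>y $ i\<bar> \<le> l" for i
  proof -
    have "l * y $ i \<le> l * l" "l * (- (y $ i)) \<le> l * l"
      using le[of "(i, True)"] le[of "(i, False)"] by (simp_all add: v_def inner_axis power2_eq_square)
    then have "y $ i \<le> l" "- (y $ i) \<le> l" using l(1) by (simp_all only: mult_le_cancel_left_pos)
    then show ?thesis by linarith
  qed
  then have "\<bar>(A *v z) $ i\<bar> \<le> L * l" for i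
    using True unfolding Az y_def[symmetric] by (simp add: abs_mult)
  then have "infnorm (A *v z) \<le> L * l"
    unfolding infnorm_cart by (intro cSup_least) auto
  then show ?thesis using z by (auto simp: l_def N_def)
qed

section \<open>Combining the two bounds\<close>

theorem theorem1:
  fixes A :: "real ^ 'n ^ 'm" and L M p :: real and h :: "real \<Rightarrow> real"
  assumes col_norm: "\<And>j. norm (column j A) \<le> L"
    and entries: "\<And>i j. \<bar>A $ i $ j\<bar> \<le> M"
    and h_range: "h ` {0<..} \<subseteq> {0..}"
    and h_antimono: "antimono_on {0<..} h"
    and row_sums: "\<And>(S :: 'n set) i. (\<Sum>j\<in>S. (A $ i $ j)\<^sup>2) \<le> real (card S) * h (real (card S))"
    and p: "p > 1"
  shows "\<exists>x :: real ^ 'n. (\<forall>j. x $ j \<in> {-1, 1}) \<and>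
           infnorm (A *v x) \<le> 5 * b0_bound h p L CARD('m) CARD('n) + 2 * M"
proof -
  have M: "M \<ge> 0" using entries abs_ge_zero order_trans by blast
  have L: "L \<ge> 0" using col_norm norm_ge_zero order_trans by blast
  \<comment> \<open>The walk yields \<open>sqrt 2 * q\<close>, well below the required
    \<open>5 * 250 * q\<close>; the term \<open>2 * M\<close> is nonnegative and can be
    added.\<close>
  define q where "q = L * sqrt (ln (2 * real CARD('m)))"
  have "q \<ge> 0" using L ln_2_card_nonneg[where 'm = 'm] by (simp add: q_def)
  moreover have "sqrt 2 \<le> (2::real)" by (rule real_le_lsqrt) auto
  ultimately have "sqrt 2 * q \<le> 1250 * q" by (intro mult_right_mono) auto
  moreover have "L * sqrt (2 * ln (2 * real CARD('m))) = sqrt 2 * q"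
    by (simp add: q_def real_sqrt_mult)
  moreover have "5 * (250 * L * sqrt (ln (2 * real CARD('m)))) = 1250 * q" by (simp add: q_def)
  ultimately have "L * sqrt (2 * ln (2 * real CARD('m)))
      \<le> 5 * (250 * L * sqrt (ln (2 * real CARD('m)))) + 2 * M" using M by linarith
  then show ?thesis
    using barrier_signs[OF entries h_range h_antimono row_sums p] banaszczyk_sqrt_log[OF col_norm]
    unfolding b0_bound_def min_def by (cases "sqrt (8 * (p + 1) * (48 * real CARD('m)) powr (1 / p) * beta_bound h p CARD('n))
       \<le> 250 * L * sqrt (ln (2 * real CARD('m)))") (auto intro: order_trans)
qed

end
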